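(* Let $R$ be a noetherian ring and let $Q=Q_1*_RQ_2$ be the amalgamated product of two quadratic extensions $Q_1$, $Q_2$ of $R$ with associated endomorphisms $\tau_1,\tau_2$ of $R$. If $\tau_1$ and $\tau_2$ are automorphisms of $R$, then $Q$ is noetherian.
   Context: Rings are associative and unital; noetherian means left and right noetherian. An extension of rings $R\subseteq A$ is quadratic if there is $x\in A\setminus R$ such that $A$ is a free left $R$-module with basis $\{1,x\}$; then there are a ring endomorphism $\tau$ of $R$, a left $\tau$-derivation $\delta$ of $R$ (a $\mathbb{Z}$-linear map with $\delta(rs)=\tau(r)\delta(s)+\delta(r)s$) and $a,b\in R$ with $xr=\tau(r)x+\delta(r)$ for all $r\in R$ and $x^2=ax+b$, and $A\cong R[x;\tau,\delta]/\langle x^2-ax-b\rangle$, where $R[x;\tau,\delta]$ is the Ore extension (free left $R$-module on $1,x,x^2,\dots$ with $xr=\tau(r)x+\delta(r)$). Fix such data $Q_1=R[x;\tau_1,\delta_1]/\langle x^2-ax-b\rangle$ and $Q_2=R[y;\tau_2,\delta_2]/\langle y^2-cy-d\rangle$ for the two quadratic extensions, with $a,b,c,d\in R$. The amalgamated product $Q_1*_RQ_2$ is the pushout, in the category of rings, of the inclusions $R\hookrightarrow Q_1$ and $R\hookrightarrow Q_2$. *)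

theory Defs
  imports "HOL-Algebra.QuotRing"
begin

section \<open>One-sided noetherian rings\<close>

text \<open>
  The \<open>ideal\<close> of HOL-Algebra is two-sided (and so is its \<open>noetherian_ring\<close>); the one-sided
  versions below mirror \<open>ideal\<close> and \<open>genideal\<close>.
\<close>

definition left_ideal :: "'a set \<Rightarrow> ('a, 'm) ring_scheme \<Rightarrow> bool" where
  "left_ideal I R \<longleftrightarrow>
     additive_subgroup I R \<and> (\<forall>r\<in>carrier R. \<forall>i\<in>I. r \<otimes>\<^bsub>R\<^esub> i \<in> I)"

definition right_ideal :: "'a set \<Rightarrow> ('a, 'm) ring_scheme \<Rightarrow> bool" where
  "right_ideal I R \<longleftrightarrow>
     additive_subgroup I R \<and> (\<forall>r\<in>carrier R. \<forall>i\<in>I. i \<otimes>\<^bsub>R\<^esub> r \<in> I)"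

definition genleftideal :: "('a, 'm) ring_scheme \<Rightarrow> 'a set \<Rightarrow> 'a set" where
  "genleftideal R S = \<Inter>{I. left_ideal I R \<and> S \<subseteq> I}"

definition genrightideal :: "('a, 'm) ring_scheme \<Rightarrow> 'a set \<Rightarrow> 'a set" where
  "genrightideal R S = \<Inter>{I. right_ideal I R \<and> S \<subseteq> I}"

definition left_noetherian :: "('a, 'm) ring_scheme \<Rightarrow> bool" where
  "left_noetherian R \<longleftrightarrow> ring R \<and>
     (\<forall>I. left_ideal I R \<longrightarrow> (\<exists>S. finite S \<and> S \<subseteq> carrier R \<and> I = genleftideal R S))"

definition right_noetherian :: "('a, 'm) ring_scheme \<Rightarrow> bool" where
  "right_noetherian R \<longleftrightarrow> ring R \<and>
     (\<forall>I. right_ideal I R \<longrightarrow> (\<exists>S. finite S \<and> S \<subseteq> carrier R \<and> I = genrightideal R S))"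

definition noetherian :: "('a, 'm) ring_scheme \<Rightarrow> bool" where
  "noetherian R \<longleftrightarrow> left_noetherian R \<and> right_noetherian R"


section \<open>Quadratic extensions\<close>

definition left_derivation ::
    "('a, 'm) ring_scheme \<Rightarrow> ('a \<Rightarrow> 'a) \<Rightarrow> ('a \<Rightarrow> 'a) \<Rightarrow> bool" where
  "left_derivation R \<tau> \<delta> \<longleftrightarrow>
     \<delta> \<in> carrier R \<rightarrow> carrier R \<and>
     (\<forall>r\<in>carrier R. \<forall>s\<in>carrier R. \<delta> (r \<oplus>\<^bsub>R\<^esub> s) = \<delta> r \<oplus>\<^bsub>R\<^esub> \<delta> s) \<and>
     (\<forall>r\<in>carrier R. \<forall>s\<in>carrier R.
        \<delta> (r \<otimes>\<^bsub>R\<^esub> s) = \<tau> r \<otimes>\<^bsub>R\<^esub> \<delta> s \<oplus>\<^bsub>R\<^esub> \<delta> r \<otimes>\<^bsub>R\<^esub> s)"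

text \<open>
  The inclusion of \<open>R\<close> into \<open>A\<close> is an injective homomorphism \<open>\<iota>\<close>, so that two extensions of
  \<open>R\<close> may have different carrier types; \<open>\<iota> = id\<close> is the case of a subring.
  Freeness on \<open>{1, x}\<close> is existence and uniqueness of the coordinates of each element.
\<close>

locale quadratic_extension = ring_hom_ring R A \<iota>
  for R :: "('r, 'm) ring_scheme" (structure)
    and A :: "('a, 'n) ring_scheme" (structure)
    and \<iota> :: "'r \<Rightarrow> 'a" +
  fixes x :: 'a and \<tau> \<delta> :: "'r \<Rightarrow> 'r" and a b :: 'r
  assumes inj: "inj_on \<iota> (carrier R)"
    and gen_closed: "x \<in> carrier A"
    and gen_notin: "x \<notin> \<iota> ` carrier R"
    and free: "\<And>z. z \<in> carrier A \<Longrightarrow>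
      \<exists>!(r, s). r \<in> carrier R \<and> s \<in> carrier R \<and> z = \<iota> r \<oplus>\<^bsub>A\<^esub> \<iota> s \<otimes>\<^bsub>A\<^esub> x"
    and endo: "\<tau> \<in> ring_hom R R"
    and deriv: "left_derivation R \<tau> \<delta>"
    and commute: "\<And>r. r \<in> carrier R \<Longrightarrow> x \<otimes>\<^bsub>A\<^esub> \<iota> r = \<iota> (\<tau> r) \<otimes>\<^bsub>A\<^esub> x \<oplus>\<^bsub>A\<^esub> \<iota> (\<delta> r)"
    and coeffs: "a \<in> carrier R" "b \<in> carrier R"
    and square: "x \<otimes>\<^bsub>A\<^esub> x = \<iota> a \<otimes>\<^bsub>A\<^esub> x \<oplus>\<^bsub>A\<^esub> \<iota> b"


section \<open>Pushouts of rings\<close>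

definition ring_cocone where
  "ring_cocone R \<iota>1 Q1 \<iota>2 Q2 T f g \<longleftrightarrow>
     ring T \<and> f \<in> ring_hom Q1 T \<and> g \<in> ring_hom Q2 T \<and> (\<forall>r\<in>carrier R. f (\<iota>1 r) = g (\<iota>2 r))"

text \<open>
  The universal property with respect to rings whose elements have type \<open>'t\<close>. Morphisms are
  made extensional, since HOL functions are unconstrained outside the carrier.
\<close>

definition ring_pushout_for ::
    "'t itself \<Rightarrow> ('r, 'm) ring_scheme \<Rightarrow> ('r \<Rightarrow> 'a) \<Rightarrow> ('a, 'n) ring_scheme \<Rightarrow>
     ('r \<Rightarrow> 'b) \<Rightarrow> ('b, 'o) ring_scheme \<Rightarrow> 'q ring \<Rightarrow>
     ('a \<Rightarrow> 'q) \<Rightarrow> ('b \<Rightarrow> 'q) \<Rightarrow> bool" where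
  "ring_pushout_for (_ :: 't itself) R \<iota>1 Q1 \<iota>2 Q2 Q j1 j2 \<longleftrightarrow>
     ring_cocone R \<iota>1 Q1 \<iota>2 Q2 Q j1 j2 \<and>
     (\<forall>(T :: 't ring) f g. ring_cocone R \<iota>1 Q1 \<iota>2 Q2 T f g \<longrightarrow>
        (\<exists>!h. h \<in> ring_hom Q T \<and> h \<in> extensional (carrier Q) \<and>
              (\<forall>u\<in>carrier Q1. h (j1 u) = f u) \<and> (\<forall>v\<in>carrier Q2. h (j2 v) = g v)))"

text \<open>
  A formula cannot quantify over types, so the universal property is required for two fixed
  types of test rings: the type of the elements of \<open>Q\<close> itself, and \<open>('a + 'b) rexp set\<close>. The
  latter contains a model \<open>amalgam\<close> of the pushout (ring expressions in the elements of both
  rings, modulo the provable equations). Together they imply the universal property for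
  every type: see \<open>ring_pushout_universal\<close> below. The second type alone would not do, since
  it does not see quotients of \<open>Q\<close> that are too large for it.
\<close>

datatype 'g rexp = Gen 'g | Zero | One | Neg "'g rexp"
  | Add "'g rexp" "'g rexp" | Mul "'g rexp" "'g rexp"

definition ring_pushout ::
    "('r, 'm) ring_scheme \<Rightarrow> ('r \<Rightarrow> 'a) \<Rightarrow> ('a, 'n) ring_scheme \<Rightarrow>
     ('r \<Rightarrow> 'b) \<Rightarrow> ('b, 'o) ring_scheme \<Rightarrow> 'q ring \<Rightarrow>
     ('a \<Rightarrow> 'q) \<Rightarrow> ('b \<Rightarrow> 'q) \<Rightarrow> bool" where
  "ring_pushout R \<iota>1 Q1 \<iota>2 Q2 Q j1 j2 \<longleftrightarrow>
     ring_pushout_for TYPE('q) R \<iota>1 Q1 \<iota>2 Q2 Q j1 j2 \<and>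
     ring_pushout_for TYPE(('a + 'b) rexp set) R \<iota>1 Q1 \<iota>2 Q2 Q j1 j2"


subsection \<open>A model of the pushout\<close>

inductive rexp_eq for R \<iota>1 Q1 \<iota>2 Q2 where
  refl: "rexp_eq R \<iota>1 Q1 \<iota>2 Q2 e e"
| sym: "rexp_eq R \<iota>1 Q1 \<iota>2 Q2 e e' \<Longrightarrow> rexp_eq R \<iota>1 Q1 \<iota>2 Q2 e' e"
| trans: "rexp_eq R \<iota>1 Q1 \<iota>2 Q2 e e' \<Longrightarrow> rexp_eq R \<iota>1 Q1 \<iota>2 Q2 e' e'' \<Longrightarrow>
    rexp_eq R \<iota>1 Q1 \<iota>2 Q2 e e''"
| Neg: "rexp_eq R \<iota>1 Q1 \<iota>2 Q2 e e' \<Longrightarrow> rexp_eq R \<iota>1 Q1 \<iota>2 Q2 (Neg e) (Neg e')"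
| Add: "rexp_eq R \<iota>1 Q1 \<iota>2 Q2 d d' \<Longrightarrow> rexp_eq R \<iota>1 Q1 \<iota>2 Q2 e e' \<Longrightarrow>
    rexp_eq R \<iota>1 Q1 \<iota>2 Q2 (Add d e) (Add d' e')"
| Mul: "rexp_eq R \<iota>1 Q1 \<iota>2 Q2 d d' \<Longrightarrow> rexp_eq R \<iota>1 Q1 \<iota>2 Q2 e e' \<Longrightarrow>
    rexp_eq R \<iota>1 Q1 \<iota>2 Q2 (Mul d e) (Mul d' e')"
| add_assoc: "rexp_eq R \<iota>1 Q1 \<iota>2 Q2 (Add (Add c d) e) (Add c (Add d e))"
| add_commute: "rexp_eq R \<iota>1 Q1 \<iota>2 Q2 (Add d e) (Add e d)"
| add_zero: "rexp_eq R \<iota>1 Q1 \<iota>2 Q2 (Add Zero e) e"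
| add_neg: "rexp_eq R \<iota>1 Q1 \<iota>2 Q2 (Add (Neg e) e) Zero"
| mul_assoc: "rexp_eq R \<iota>1 Q1 \<iota>2 Q2 (Mul (Mul c d) e) (Mul c (Mul d e))"
| mul_one_left: "rexp_eq R \<iota>1 Q1 \<iota>2 Q2 (Mul One e) e"
| mul_one_right: "rexp_eq R \<iota>1 Q1 \<iota>2 Q2 (Mul e One) e"
| distrib_right: "rexp_eq R \<iota>1 Q1 \<iota>2 Q2 (Mul (Add c d) e) (Add (Mul c e) (Mul d e))"
| distrib_left: "rexp_eq R \<iota>1 Q1 \<iota>2 Q2 (Mul c (Add d e)) (Add (Mul c d) (Mul c e))"
| inl_add: "u \<in> carrier Q1 \<Longrightarrow> v \<in> carrier Q1 \<Longrightarrow>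
    rexp_eq R \<iota>1 Q1 \<iota>2 Q2 (Gen (Inl (u \<oplus>\<^bsub>Q1\<^esub> v))) (Add (Gen (Inl u)) (Gen (Inl v)))"
| inl_mul: "u \<in> carrier Q1 \<Longrightarrow> v \<in> carrier Q1 \<Longrightarrow>
    rexp_eq R \<iota>1 Q1 \<iota>2 Q2 (Gen (Inl (u \<otimes>\<^bsub>Q1\<^esub> v))) (Mul (Gen (Inl u)) (Gen (Inl v)))"
| inl_one: "rexp_eq R \<iota>1 Q1 \<iota>2 Q2 (Gen (Inl \<one>\<^bsub>Q1\<^esub>)) One"
| inl_out: "u \<notin> carrier Q1 \<Longrightarrow> rexp_eq R \<iota>1 Q1 \<iota>2 Q2 (Gen (Inl u)) Zero"
| inr_add: "u \<in> carrier Q2 \<Longrightarrow> v \<in> carrier Q2 \<Longrightarrow>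
    rexp_eq R \<iota>1 Q1 \<iota>2 Q2 (Gen (Inr (u \<oplus>\<^bsub>Q2\<^esub> v))) (Add (Gen (Inr u)) (Gen (Inr v)))"
| inr_mul: "u \<in> carrier Q2 \<Longrightarrow> v \<in> carrier Q2 \<Longrightarrow>
    rexp_eq R \<iota>1 Q1 \<iota>2 Q2 (Gen (Inr (u \<otimes>\<^bsub>Q2\<^esub> v))) (Mul (Gen (Inr u)) (Gen (Inr v)))"
| inr_one: "rexp_eq R \<iota>1 Q1 \<iota>2 Q2 (Gen (Inr \<one>\<^bsub>Q2\<^esub>)) One"
| inr_out: "u \<notin> carrier Q2 \<Longrightarrow> rexp_eq R \<iota>1 Q1 \<iota>2 Q2 (Gen (Inr u)) Zero"
| glue: "r \<in> carrier R \<Longrightarrow>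
    rexp_eq R \<iota>1 Q1 \<iota>2 Q2 (Gen (Inl (\<iota>1 r))) (Gen (Inr (\<iota>2 r)))"

definition rexp_class where
  "rexp_class R \<iota>1 Q1 \<iota>2 Q2 e = {e'. rexp_eq R \<iota>1 Q1 \<iota>2 Q2 e e'}"

definition rexp_rep :: "'g rexp set \<Rightarrow> 'g rexp" where
  "rexp_rep X = (SOME e. e \<in> X)"

definition amalgam ::
    "('r, 'm) ring_scheme \<Rightarrow> ('r \<Rightarrow> 'a) \<Rightarrow> ('a, 'n) ring_scheme \<Rightarrow>
     ('r \<Rightarrow> 'b) \<Rightarrow> ('b, 'o) ring_scheme \<Rightarrow> ('a + 'b) rexp set ring" where
  "amalgam R \<iota>1 Q1 \<iota>2 Q2 =
     \<lparr>carrier = range (rexp_class R \<iota>1 Q1 \<iota>2 Q2),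
      monoid.mult = (\<lambda>X Y. rexp_class R \<iota>1 Q1 \<iota>2 Q2 (Mul (rexp_rep X) (rexp_rep Y))),
      one = rexp_class R \<iota>1 Q1 \<iota>2 Q2 One,
      zero = rexp_class R \<iota>1 Q1 \<iota>2 Q2 Zero,
      add = (\<lambda>X Y. rexp_class R \<iota>1 Q1 \<iota>2 Q2 (Add (rexp_rep X) (rexp_rep Y)))\<rparr>"

definition amalgam_inl where
  "amalgam_inl R \<iota>1 Q1 \<iota>2 Q2 u = rexp_class R \<iota>1 Q1 \<iota>2 Q2 (Gen (Inl u))"

definition amalgam_inr where
  "amalgam_inr R \<iota>1 Q1 \<iota>2 Q2 v = rexp_class R \<iota>1 Q1 \<iota>2 Q2 (Gen (Inr v))"

primrec rexp_eval where
  "rexp_eval Q1 Q2 T f g (Gen w) =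
     (case w of Inl u \<Rightarrow> (if u \<in> carrier Q1 then f u else \<zero>\<^bsub>T\<^esub>)
              | Inr v \<Rightarrow> (if v \<in> carrier Q2 then g v else \<zero>\<^bsub>T\<^esub>))"
| "rexp_eval Q1 Q2 T f g Zero = \<zero>\<^bsub>T\<^esub>"
| "rexp_eval Q1 Q2 T f g One = \<one>\<^bsub>T\<^esub>"
| "rexp_eval Q1 Q2 T f g (Neg e) = \<ominus>\<^bsub>T\<^esub> rexp_eval Q1 Q2 T f g e"
| "rexp_eval Q1 Q2 T f g (Add d e) = rexp_eval Q1 Q2 T f g d \<oplus>\<^bsub>T\<^esub> rexp_eval Q1 Q2 T f g e"
| "rexp_eval Q1 Q2 T f g (Mul d e) = rexp_eval Q1 Q2 T f g d \<otimes>\<^bsub>T\<^esub> rexp_eval Q1 Q2 T f g e"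

lemma rexp_class_eq_iff:
  "rexp_class R \<iota>1 Q1 \<iota>2 Q2 d = rexp_class R \<iota>1 Q1 \<iota>2 Q2 e \<longleftrightarrow> rexp_eq R \<iota>1 Q1 \<iota>2 Q2 d e"
  unfolding rexp_class_def by (auto intro: rexp_eq.intros)

lemma rexp_rep_class: "rexp_eq R \<iota>1 Q1 \<iota>2 Q2 e (rexp_rep (rexp_class R \<iota>1 Q1 \<iota>2 Q2 e))"
  unfolding rexp_rep_def rexp_class_def by (rule someI2[of _ e]) (auto intro: rexp_eq.intros)

context
  fixes R :: "('r, 'm) ring_scheme" and \<iota>1 :: "'r \<Rightarrow> 'a" and Q1 :: "('a, 'n) ring_scheme"
    and \<iota>2 :: "'r \<Rightarrow> 'b" and Q2 :: "('b, 'o) ring_scheme"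
begin

private abbreviation (input) "EQ \<equiv> rexp_eq R \<iota>1 Q1 \<iota>2 Q2"
private abbreviation (input) "CL \<equiv> rexp_class R \<iota>1 Q1 \<iota>2 Q2"
private abbreviation (input) "AM \<equiv> amalgam R \<iota>1 Q1 \<iota>2 Q2"

lemma amalgam_simps:
  "carrier AM = range CL" "\<one>\<^bsub>AM\<^esub> = CL One" "\<zero>\<^bsub>AM\<^esub> = CL Zero"
  "CL d \<otimes>\<^bsub>AM\<^esub> CL e = CL (Mul d e)" "CL d \<oplus>\<^bsub>AM\<^esub> CL e = CL (Add d e)"
proof -
  have rep: "EQ (rexp_rep (CL e)) e" for e
    by (rule rexp_eq.sym[OF rexp_rep_class])
  show "CL d \<otimes>\<^bsub>AM\<^esub> CL e = CL (Mul d e)" "CL d \<oplus>\<^bsub>AM\<^esub> CL e = CL (Add d e)"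
    by (simp_all add: amalgam_def rexp_class_eq_iff rexp_eq.Mul rexp_eq.Add rep)
qed (simp_all add: amalgam_def)

lemma amalgam_ring: "ring AM"
proof (rule ringI)
  show "abelian_group AM"
  proof (rule abelian_groupI)
    fix X assume "X \<in> carrier AM"
    then obtain e where "X = CL e" by (auto simp: amalgam_simps)
    then have "CL (Neg e) \<in> carrier AM \<and> CL (Neg e) \<oplus>\<^bsub>AM\<^esub> X = \<zero>\<^bsub>AM\<^esub>"
      by (simp add: amalgam_simps rangeI rexp_class_eq_iff rexp_eq.add_neg)
    then show "\<exists>Y\<in>carrier AM. Y \<oplus>\<^bsub>AM\<^esub> X = \<zero>\<^bsub>AM\<^esub>" by blast
  qed (auto simp: amalgam_simps rangeI rexp_class_eq_iff intro: rexp_eq.intros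
      del: equalityI)
  show "monoid AM"
    by (rule monoidI) (auto simp: amalgam_simps rangeI rexp_class_eq_iff intro: rexp_eq.intros
      del: equalityI)
qed (auto simp: amalgam_simps rangeI rexp_class_eq_iff intro: rexp_eq.intros
      del: equalityI)

lemma amalgam_cocone:
  "ring_cocone R \<iota>1 Q1 \<iota>2 Q2 AM (amalgam_inl R \<iota>1 Q1 \<iota>2 Q2) (amalgam_inr R \<iota>1 Q1 \<iota>2 Q2)"
  unfolding ring_cocone_def
  by (intro conjI ring_hom_memI ballI)
    (simp_all add: amalgam_ring amalgam_inl_def amalgam_inr_def amalgam_simps rangeI rexp_class_eq_iff
      rexp_eq.inl_add rexp_eq.inl_mul rexp_eq.inl_one rexp_eq.inr_add rexp_eq.inr_mul
      rexp_eq.inr_one rexp_eq.glue)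

context
  fixes T :: "('t, 'k) ring_scheme" and f g
  assumes cocone: "ring_cocone R \<iota>1 Q1 \<iota>2 Q2 T f g"
    and rings: "ring Q1" "ring Q2"
    and maps: "\<And>r. r \<in> carrier R \<Longrightarrow> \<iota>1 r \<in> carrier Q1" "\<And>r. r \<in> carrier R \<Longrightarrow> \<iota>2 r \<in> carrier Q2"
begin

private abbreviation (input) "EV \<equiv> rexp_eval Q1 Q2 T f g"

lemma rexp_eval_closed: "EV e \<in> carrier T"
proof -
  interpret T: ring T using cocone by (simp add: ring_cocone_def)
  from cocone have "f \<in> ring_hom Q1 T" "g \<in> ring_hom Q2 T" by (simp_all add: ring_cocone_def)
  then show ?thesis by (induction e) (auto split: sum.split simp: ring_hom_closed)
qed

lemma rexp_eval_eq: "EQ d e \<Longrightarrow> EV d = EV e"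
proof -
  interpret T: ring T using cocone by (simp add: ring_cocone_def)
  interpret Q1: ring Q1 by (fact rings)
  interpret Q2: ring Q2 by (fact rings)
  note [simp] = rexp_eval_closed
  from cocone have hom: "f \<in> ring_hom Q1 T" "g \<in> ring_hom Q2 T"
    and glue: "\<And>r. r \<in> carrier R \<Longrightarrow> f (\<iota>1 r) = g (\<iota>2 r)" by (simp_all add: ring_cocone_def)
  show "EQ d e \<Longrightarrow> EV d = EV e"
    by (induction rule: rexp_eq.induct)
      (simp_all add: T.a_ac T.l_neg T.r_neg T.m_assoc T.l_distr T.r_distr maps glue
        ring_hom_add[OF hom(1)] ring_hom_mult[OF hom(1)] ring_hom_one[OF hom(1)]
        ring_hom_add[OF hom(2)] ring_hom_mult[OF hom(2)] ring_hom_one[OF hom(2)])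
qed

lemma amalgam_universal:
  "\<exists>!h. h \<in> ring_hom AM T \<and> h \<in> extensional (carrier AM) \<and>
     (\<forall>u\<in>carrier Q1. h (amalgam_inl R \<iota>1 Q1 \<iota>2 Q2 u) = f u) \<and>
     (\<forall>v\<in>carrier Q2. h (amalgam_inr R \<iota>1 Q1 \<iota>2 Q2 v) = g v)"
proof (rule ex1I)
  interpret T: ring T using cocone by (simp add: ring_cocone_def)
  interpret AM: ring AM by (rule amalgam_ring)
  let ?h = "\<lambda>X\<in>carrier AM. EV (rexp_rep X)"
  have h: "?h (CL e) = EV e" for e
    using rexp_eval_eq[OF rexp_rep_class[of R \<iota>1 Q1 \<iota>2 Q2 e]] by (simp add: amalgam_simps)
  have "?h \<in> ring_hom AM T"
  proof (rule ring_hom_memI)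
    fix X Y assume "X \<in> carrier AM" "Y \<in> carrier AM"
    then obtain d e where XY: "X = CL d" "Y = CL e" by (auto simp: amalgam_simps)
    show "?h X \<in> carrier T" unfolding XY h by (rule rexp_eval_closed)
    show "?h (X \<otimes>\<^bsub>AM\<^esub> Y) = ?h X \<otimes>\<^bsub>T\<^esub> ?h Y" "?h (X \<oplus>\<^bsub>AM\<^esub> Y) = ?h X \<oplus>\<^bsub>T\<^esub> ?h Y"
      unfolding XY amalgam_simps(4,5) h by simp_all
  next
    show "?h \<one>\<^bsub>AM\<^esub> = \<one>\<^bsub>T\<^esub>" unfolding amalgam_simps(2) h by simp
  qed
  then show "?h \<in> ring_hom AM T \<and> ?h \<in> extensional (carrier AM) \<and>
     (\<forall>u\<in>carrier Q1. ?h (amalgam_inl R \<iota>1 Q1 \<iota>2 Q2 u) = f u) \<and>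
     (\<forall>v\<in>carrier Q2. ?h (amalgam_inr R \<iota>1 Q1 \<iota>2 Q2 v) = g v)"
    unfolding amalgam_inl_def amalgam_inr_def h by simp
  fix k
  assume k: "k \<in> ring_hom AM T \<and> k \<in> extensional (carrier AM) \<and>
     (\<forall>u\<in>carrier Q1. k (amalgam_inl R \<iota>1 Q1 \<iota>2 Q2 u) = f u) \<and>
     (\<forall>v\<in>carrier Q2. k (amalgam_inr R \<iota>1 Q1 \<iota>2 Q2 v) = g v)"
  interpret k: ring_hom_ring AM T k
    using k by (intro ring_hom_ringI2 AM.ring_axioms T.ring_axioms) simp
  have cl: "CL e \<in> carrier AM" for e by (simp add: amalgam_simps)
  have zero: "k (CL Zero) = \<zero>\<^bsub>T\<^esub>" using k.hom_zero by (simp add: amalgam_simps)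
  have "k (CL e) = EV e" for e
  proof (induction e)
    case (Gen w)
    show ?case
    proof (cases w)
      case (Inl u)
      have "CL (Gen (Inl u)) = CL Zero" if "u \<notin> carrier Q1"
        using that by (simp add: rexp_class_eq_iff rexp_eq.inl_out)
      then show ?thesis using k Inl zero by (auto simp: amalgam_inl_def)
    next
      case (Inr u)
      have "CL (Gen (Inr u)) = CL Zero" if "u \<notin> carrier Q2"
        using that by (simp add: rexp_class_eq_iff rexp_eq.inr_out)
      then show ?thesis using k Inr zero by (auto simp: amalgam_inr_def)
    qed
  next
    case Zero then show ?case using zero by simp
  next
    case One then show ?case using k.hom_one by (simp add: amalgam_simps)
  next
    case (Neg e)
    have "CL (Neg e) \<oplus>\<^bsub>AM\<^esub> CL e = \<zero>\<^bsub>AM\<^esub>"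
      by (simp add: amalgam_simps rexp_class_eq_iff rexp_eq.add_neg)
    then have "k (CL (Neg e)) \<oplus>\<^bsub>T\<^esub> k (CL e) = \<zero>\<^bsub>T\<^esub>"
      by (metis cl k.hom_add k.hom_zero)
    then have "k (CL (Neg e)) = \<ominus>\<^bsub>T\<^esub> k (CL e)"
      using cl k.hom_closed T.minus_equality by metis
    then show ?case using Neg by simp
  next
    case (Add d e)
    then show ?case using k.hom_add[OF cl cl, of d e] by (simp add: amalgam_simps)
  next
    case (Mul d e)
    then show ?case using k.hom_mult[OF cl cl, of d e] by (simp add: amalgam_simps)
  qed
  then have "k X = ?h X" if "X \<in> carrier AM" for X
  proof -
    obtain e where X: "X = CL e" using \<open>X \<in> carrier AM\<close> by (auto simp: amalgam_simps)
    show ?thesis unfolding X h by fact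
  qed
  then show "k = ?h"
    using k by (intro extensionalityI[of _ "carrier AM"]) simp_all
qed

end

lemma amalgam_pushout_for:
  assumes "ring_hom_ring R Q1 \<iota>1" "ring_hom_ring R Q2 \<iota>2"
  shows "ring_pushout_for TYPE('t) R \<iota>1 Q1 \<iota>2 Q2 AM
           (amalgam_inl R \<iota>1 Q1 \<iota>2 Q2) (amalgam_inr R \<iota>1 Q1 \<iota>2 Q2)"
proof -
  interpret i1: ring_hom_ring R Q1 \<iota>1 by fact
  interpret i2: ring_hom_ring R Q2 \<iota>2 by fact
  show ?thesis
    unfolding ring_pushout_for_def
    by (intro conjI allI impI amalgam_cocone amalgam_universal i1.S.ring_axioms i2.S.ring_axioms)
      simp_all
qed

end

theorem ring_pushout_exists:
  assumes "ring_hom_ring R Q1 \<iota>1" "ring_hom_ring R Q2 \<iota>2"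
  shows "ring_pushout R \<iota>1 Q1 \<iota>2 Q2 (amalgam R \<iota>1 Q1 \<iota>2 Q2)
           (amalgam_inl R \<iota>1 Q1 \<iota>2 Q2) (amalgam_inr R \<iota>1 Q1 \<iota>2 Q2)"
  unfolding ring_pushout_def by (intro conjI amalgam_pushout_for[OF assms])

lemma ex1_unique: "\<exists>!k. P k \<Longrightarrow> P k \<Longrightarrow> P k' \<Longrightarrow> k = k'"
  by blast

theorem ring_pushout_universal:
  fixes R :: "('r, 'm) ring_scheme"
    and Q1 :: "('a, 'n) ring_scheme" and Q2 :: "('b, 'o) ring_scheme"
    and Q :: "'q ring"
  assumes hom: "ring_hom_ring R Q1 \<iota>1" "ring_hom_ring R Q2 \<iota>2"
    and po: "ring_pushout R \<iota>1 Q1 \<iota>2 Q2 Q j1 j2"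
  shows "ring_pushout_for TYPE('t) R \<iota>1 Q1 \<iota>2 Q2 Q j1 j2"
proof -
  interpret i1: ring_hom_ring R Q1 \<iota>1 by fact
  interpret i2: ring_hom_ring R Q2 \<iota>2 by fact
  define A where "A = amalgam R \<iota>1 Q1 \<iota>2 Q2"
  define l where "l = amalgam_inl R \<iota>1 Q1 \<iota>2 Q2"
  define m where "m = amalgam_inr R \<iota>1 Q1 \<iota>2 Q2"
  have coA: "ring_cocone R \<iota>1 Q1 \<iota>2 Q2 A l m"
    unfolding A_def l_def m_def by (rule amalgam_cocone)
  have uniA: "\<exists>!h. h \<in> ring_hom A T \<and> h \<in> extensional (carrier A) \<and>
       (\<forall>u\<in>carrier Q1. h (l u) = f u) \<and> (\<forall>v\<in>carrier Q2. h (m v) = g v)"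
    if "ring_cocone R \<iota>1 Q1 \<iota>2 Q2 T f g" for T :: "'s ring" and f g
    unfolding A_def l_def m_def
    by (rule amalgam_universal[OF that i1.S.ring_axioms i2.S.ring_axioms]) simp_all
  have coQ: "ring_cocone R \<iota>1 Q1 \<iota>2 Q2 Q j1 j2"
    using po unfolding ring_pushout_def ring_pushout_for_def by auto
  have jcl: "\<And>u. u \<in> carrier Q1 \<Longrightarrow> j1 u \<in> carrier Q" "\<And>v. v \<in> carrier Q2 \<Longrightarrow> j2 v \<in> carrier Q"
    using coQ by (auto simp: ring_cocone_def ring_hom_closed)
  have lcl: "\<And>u. u \<in> carrier Q1 \<Longrightarrow> l u \<in> carrier A" "\<And>v. v \<in> carrier Q2 \<Longrightarrow> m v \<in> carrier A"
    using coA by (auto simp: ring_cocone_def ring_hom_closed)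
  obtain p where p: "p \<in> ring_hom Q A" "\<forall>u\<in>carrier Q1. p (j1 u) = l u"
      "\<forall>v\<in>carrier Q2. p (j2 v) = m v"
    using ex1_implies_ex[OF po[unfolded ring_pushout_def ring_pushout_for_def,
        THEN conjunct2, THEN conjunct2, rule_format, OF coA]] by blast
  obtain q where q: "q \<in> ring_hom A Q" "\<forall>u\<in>carrier Q1. q (l u) = j1 u"
      "\<forall>v\<in>carrier Q2. q (m v) = j2 v"
    using ex1_implies_ex[OF uniA[OF coQ]] by blast
  have res: "restrict k (carrier S) \<in> ring_hom S T" if "k \<in> ring_hom S T" "ring S"
    for k and S :: "'u ring" and T :: "'v ring"
  proof -
    interpret S: ring S by fact
    show ?thesis using that(1) by (auto simp: ring_hom_def)
  qed
  have ringQ: "ring Q" and ringA: "ring A"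
    using coQ coA by (simp_all add: ring_cocone_def)
  have qp: "q (p z) = z" if z: "z \<in> carrier Q" for z
  proof -
    have ex1: "\<exists>!h. h \<in> ring_hom Q Q \<and> h \<in> extensional (carrier Q) \<and>
        (\<forall>u\<in>carrier Q1. h (j1 u) = j1 u) \<and> (\<forall>v\<in>carrier Q2. h (j2 v) = j2 v)"
      by (rule po[unfolded ring_pushout_def ring_pushout_for_def,
            THEN conjunct1, THEN conjunct2, rule_format, OF coQ])
    have id: "id \<in> ring_hom Q Q" by (auto simp: ring_hom_def)
    have "restrict (q \<circ> p) (carrier Q) = restrict id (carrier Q)"
      by (rule ex1_unique[OF ex1])
        (use res[OF ring_hom_trans[OF p(1) q(1)] ringQ] res[OF id ringQ] p q jcl in simp_all)
    from fun_cong[OF this, of z] z show ?thesis by simp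
  qed
  have "\<exists>!h. h \<in> ring_hom Q T \<and> h \<in> extensional (carrier Q) \<and>
       (\<forall>u\<in>carrier Q1. h (j1 u) = f u) \<and> (\<forall>v\<in>carrier Q2. h (j2 v) = g v)"
    if co: "ring_cocone R \<iota>1 Q1 \<iota>2 Q2 T f g" for T :: "'t ring" and f g
  proof (rule ex_ex1I)
    obtain k where k: "k \<in> ring_hom A T" "\<forall>u\<in>carrier Q1. k (l u) = f u"
        "\<forall>v\<in>carrier Q2. k (m v) = g v"
      using ex1_implies_ex[OF uniA[OF co]] by blast
    show "\<exists>h. h \<in> ring_hom Q T \<and> h \<in> extensional (carrier Q) \<and>
       (\<forall>u\<in>carrier Q1. h (j1 u) = f u) \<and> (\<forall>v\<in>carrier Q2. h (j2 v) = g v)"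
      using res[OF ring_hom_trans[OF p(1) k(1)] ringQ] p k jcl
      by (intro exI[of _ "restrict (k \<circ> p) (carrier Q)"]) simp
  next
    fix h h'
    assume h: "h \<in> ring_hom Q T \<and> h \<in> extensional (carrier Q) \<and>
       (\<forall>u\<in>carrier Q1. h (j1 u) = f u) \<and> (\<forall>v\<in>carrier Q2. h (j2 v) = g v)"
      and h': "h' \<in> ring_hom Q T \<and> h' \<in> extensional (carrier Q) \<and>
       (\<forall>u\<in>carrier Q1. h' (j1 u) = f u) \<and> (\<forall>v\<in>carrier Q2. h' (j2 v) = g v)"
    let ?P = "\<lambda>k. k \<in> ring_hom A T \<and> k \<in> extensional (carrier A) \<and>
       (\<forall>u\<in>carrier Q1. k (l u) = f u) \<and> (\<forall>v\<in>carrier Q2. k (m v) = g v)"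
    have "?P (restrict (h \<circ> q) (carrier A))" "?P (restrict (h' \<circ> q) (carrier A))"
      using res[OF ring_hom_trans[OF q(1) conjunct1[OF h]] ringA]
        res[OF ring_hom_trans[OF q(1) conjunct1[OF h']] ringA] h h' q lcl by simp_all
    then have eq: "restrict (h \<circ> q) (carrier A) = restrict (h' \<circ> q) (carrier A)"
      by (rule ex1_unique[OF uniA[OF co]])
    show "h = h'"
    proof (rule extensionalityI[of _ "carrier Q"])
      fix z assume z: "z \<in> carrier Q"
      then have "p z \<in> carrier A" using p(1) by (rule ring_hom_closed[rotated])
      with fun_cong[OF eq, of "p z"] qp[OF z] show "h z = h' z" by simp
    qed (use h h' in auto)
  qed
  with coQ show ?thesis unfolding ring_pushout_for_def by blast
qed

end

theory Submission
  imports Defs "HOL-Algebra.Subrings"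
begin

text \<open>
  The proof is a Hilbert basis argument. Write \<open>z\<close> for the two generators \<open>x\<close>, \<open>y\<close>, indexed by a
  boolean. Because of \<open>z r = \<tau>(r) z + \<delta>(r)\<close> and of the quadratic relations, \<open>Q\<close> is spanned
  as a left \<open>R\<close>-module by \<open>1\<close> and the alternating words in \<open>x\<close> and \<open>y\<close>, and there are
  just two of these in each positive degree. Filter \<open>Q\<close> by degree
  (\<open>carrier_eq_Union_degree_le\<close>). Each filtration step is generated over \<open>R\<close> by finitely many
  elements, so it is a noetherian \<open>R\<close>-module (\<open>noetherian_degree_le\<close>).

  Let \<open>I\<close> be a left ideal of \<open>Q\<close>. For each word \<open>w\<close> of degree \<open>n\<close>, the coefficients of \<open>w\<close> in the
  elements of \<open>I\<close> of degree at most \<open>n\<close> form a left ideal of \<open>R\<close>. Multiplying an element on the left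
  by \<open>x\<close> raises the degree of the word that begins with \<open>y\<close>, applies \<open>\<tau>1\<close> to its
  coefficient, and sends the word that begins with \<open>x\<close> to lower terms because of the quadratic
  relation; so the two leading coefficients of an element are separated, and each
  of the two ideals is carried by \<open>\<tau>1\<close> or \<open>\<tau>2\<close> into an ideal of the next degree (\<open>lead_Suc\<close>).
  As \<open>\<tau>1\<close> and \<open>\<tau>2\<close> are automorphisms, these twisted inclusions can be untwisted to two genuine ascending
  chains of left ideals of \<open>R\<close>, which become stationary (\<open>lead_eventually_shift\<close>). From
  then on every leading term of \<open>I\<close> is produced by left multiplication from an element of \<open>I\<close> of
  smaller degree, so that \<open>I\<close> is generated by its elements of bounded degree, and finitely
  many of those suffice (\<open>left_noetherian_extension\<close>).

  The hypotheses are symmetric: solving the commutation rule for \<open>r z\<close> shows that the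
  opposite ring is of the same kind over the opposite of \<open>R\<close>, with the inverse
  automorphisms (\<open>alternating_extension_opposite\<close>). This gives the right-hand half.

  The pushout enters through generation by \<open>R\<close>, \<open>x\<close> and \<open>y\<close>, which is the uniqueness part of its
  universal property (\<open>ring_pushout_generated\<close>).
\<close>

section \<open>Ascending chains of left ideals\<close>

lemma left_idealI:
  assumes "ring R" "I \<subseteq> carrier R" "\<zero>\<^bsub>R\<^esub> \<in> I"
    and add: "\<And>u v. u \<in> I \<Longrightarrow> v \<in> I \<Longrightarrow> u \<oplus>\<^bsub>R\<^esub> v \<in> I"
    and mult: "\<And>r u. r \<in> carrier R \<Longrightarrow> u \<in> I \<Longrightarrow> r \<otimes>\<^bsub>R\<^esub> u \<in> I"
  shows "left_ideal I R"
proof -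
  interpret ring R by fact
  have "\<ominus>\<^bsub>R\<^esub> u \<in> I" if "u \<in> I" for u
    using mult[OF a_inv_closed[OF one_closed] that] that assms(2) by (auto simp: l_minus)
  with assms have "subgroup I (add_monoid R)"
    by (intro add.subgroupI) auto
  then show ?thesis
    by (simp add: left_ideal_def additive_subgroup_def mult)
qed

lemma left_idealD:
  assumes "left_ideal I R"
  shows "I \<subseteq> carrier R" "\<zero>\<^bsub>R\<^esub> \<in> I"
    and "\<And>u v. u \<in> I \<Longrightarrow> v \<in> I \<Longrightarrow> u \<oplus>\<^bsub>R\<^esub> v \<in> I"
    and "\<And>r u. r \<in> carrier R \<Longrightarrow> u \<in> I \<Longrightarrow> r \<otimes>\<^bsub>R\<^esub> u \<in> I"
proof -
  interpret additive_subgroup I R using assms by (simp add: left_ideal_def)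
  show "I \<subseteq> carrier R" "\<zero>\<^bsub>R\<^esub> \<in> I"
    "\<And>u v. u \<in> I \<Longrightarrow> v \<in> I \<Longrightarrow> u \<oplus>\<^bsub>R\<^esub> v \<in> I"
    "\<And>r u. r \<in> carrier R \<Longrightarrow> u \<in> I \<Longrightarrow> r \<otimes>\<^bsub>R\<^esub> u \<in> I"
    using assms a_subset by (auto simp: left_ideal_def)
qed

lemma left_noetherian_generators:
  assumes "left_noetherian R" "left_ideal I R"
  obtains S where "finite S" "S \<subseteq> I" "\<And>J. left_ideal J R \<Longrightarrow> S \<subseteq> J \<Longrightarrow> I \<subseteq> J"
proof -
  obtain S where S: "finite S" "I = genleftideal R S"
    using assms unfolding left_noetherian_def by blast
  show ?thesis
    by (rule that[OF S(1)]) (auto simp: S(2) genleftideal_def)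
qed

lemma left_noetherianI:
  assumes "ring R"
    and "\<And>I. left_ideal I R \<Longrightarrow>
      \<exists>S. finite S \<and> S \<subseteq> I \<and> (\<forall>J. left_ideal J R \<and> S \<subseteq> J \<longrightarrow> I \<subseteq> J)"
  shows "left_noetherian R"
  unfolding left_noetherian_def
proof (intro conjI allI impI assms(1))
  fix I assume I: "left_ideal I R"
  obtain S where S: "finite S" "S \<subseteq> I" "\<forall>J. left_ideal J R \<and> S \<subseteq> J \<longrightarrow> I \<subseteq> J"
    using assms(2)[OF I] by (elim exE conjE)
  have "I = genleftideal R S"
  proof
    show "I \<subseteq> genleftideal R S" unfolding genleftideal_def using S(3) by (intro Inter_greatest) simp
    show "genleftideal R S \<subseteq> I" unfolding genleftideal_def using I S(2) by (intro Inter_lower) simp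
  qed
  moreover have "S \<subseteq> carrier R" using S(2) left_idealD(1)[OF I] by (rule order_trans)
  ultimately show "\<exists>S. finite S \<and> S \<subseteq> carrier R \<and> I = genleftideal R S" using S(1) by (intro exI conjI)
qed

lemma left_noetherian_chain_stabilizes:
  fixes J :: "nat \<Rightarrow> 'r set"
  assumes noeth: "left_noetherian R"
    and ideal: "\<And>n. left_ideal (J n) R" and chain: "\<And>n. J n \<subseteq> J (Suc n)"
  shows "\<exists>N. \<forall>n\<ge>N. J n = J N"
proof -
  note mono = lift_Suc_mono_le[of J, OF chain]
  have "left_ideal (\<Union>n. J n) R"
  proof (rule left_idealI)
    show "ring R" using noeth by (simp add: left_noetherian_def)
    fix u v assume "u \<in> (\<Union>n. J n)" "v \<in> (\<Union>n. J n)"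
    then obtain m n where "u \<in> J m" "v \<in> J n" by blast
    then have "u \<in> J (max m n)" "v \<in> J (max m n)"
      using mono[of m "max m n"] mono[of n "max m n"] by auto
    then show "u \<oplus>\<^bsub>R\<^esub> v \<in> (\<Union>n. J n)" using left_idealD(3)[OF ideal] by blast
  next
    show "(\<Union>n. J n) \<subseteq> carrier R" using left_idealD(1)[OF ideal] by blast
    show "\<zero>\<^bsub>R\<^esub> \<in> (\<Union>n. J n)" using left_idealD(2)[OF ideal] by blast
    show "r \<otimes>\<^bsub>R\<^esub> u \<in> (\<Union>n. J n)" if "r \<in> carrier R" "u \<in> (\<Union>n. J n)" for r u
      using that left_idealD(4)[OF ideal] by blast
  qed
  then obtain S where S: "finite S" "S \<subseteq> (\<Union>n. J n)"
      "\<And>I. left_ideal I R \<Longrightarrow> S \<subseteq> I \<Longrightarrow> (\<Union>n. J n) \<subseteq> I"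
    using left_noetherian_generators[OF noeth] by metis
  have "\<exists>N. S \<subseteq> J N"
    using S(1,2)
  proof (induction S)
    case (insert s S)
    then obtain m n where "S \<subseteq> J m" "s \<in> J n" by blast
    then have "insert s S \<subseteq> J (max m n)"
      using mono[of m "max m n"] mono[of n "max m n"] by auto
    then show ?case ..
  qed simp
  then obtain N where "S \<subseteq> J N" ..
  then have "J n \<subseteq> J N" for n using S(3)[OF ideal] by blast
  then have "J n = J N" if "n \<ge> N" for n using mono[OF that] by (intro equalityI)
  then show ?thesis by blast
qed


section \<open>Modules over the base ring\<close>

lemma (in ring) minus_cancel_left:
  assumes "u \<in> carrier R" "v \<in> carrier R" "w \<in> carrier R"
  shows "(u \<oplus> v) \<ominus> (u \<oplus> w) = v \<ominus> w"
proof -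
  have "(u \<oplus> v) \<ominus> (u \<oplus> w) = (u \<oplus> \<ominus> u) \<oplus> (v \<oplus> \<ominus> w)"
    using assms unfolding minus_eq
    by (simp only: minus_add a_ac a_closed a_inv_closed add.m_closed)
  also have "\<dots> = v \<ominus> w"
    using assms by (simp add: r_neg minus_eq)
  finally show ?thesis .
qed

text \<open>
  \<open>Q\<close> is regarded as a left \<open>R\<close>-module along \<open>\<eta>\<close>. The coefficients of an element with respect to
  a generating set are in general not unique, so the ideals of leading coefficients below
  collect those of all possible representations.
\<close>

locale ring_over = ring_hom_ring R Q \<eta>
  for R :: "('r, 'm) ring_scheme" and Q :: "('q, 'n) ring_scheme" (structure)
    and \<eta> :: "'r \<Rightarrow> 'q"
begin

definition left_submodule :: "'q set \<Rightarrow> bool" where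
  "left_submodule N \<longleftrightarrow> N \<subseteq> carrier Q \<and> \<zero> \<in> N \<and> (\<forall>u\<in>N. \<forall>v\<in>N. u \<oplus> v \<in> N) \<and>
     (\<forall>r\<in>carrier R. \<forall>u\<in>N. \<eta> r \<otimes> u \<in> N)"

text \<open>
  Finite generation is phrased by testing against all submodules that contain the generators;
  this avoids a separate notion of linear span.
\<close>
definition noetherian_submodule :: "'q set \<Rightarrow> bool" where
  "noetherian_submodule M \<longleftrightarrow> (\<forall>N. left_submodule N \<and> N \<subseteq> M \<longrightarrow>
     (\<exists>G. finite G \<and> G \<subseteq> N \<and> (\<forall>N'. left_submodule N' \<and> G \<subseteq> N' \<longrightarrow> N \<subseteq> N')))"

definition adjoin :: "'q \<Rightarrow> 'q set \<Rightarrow> 'q set" where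
  "adjoin u M = {\<eta> r \<otimes> u \<oplus> m | r m. r \<in> carrier R \<and> m \<in> M}"

definition leading_coeffs :: "'q \<Rightarrow> 'q set \<Rightarrow> 'q set \<Rightarrow> 'r set" where
  "leading_coeffs u M N = {r \<in> carrier R. \<exists>m\<in>M. \<eta> r \<otimes> u \<oplus> m \<in> N}"

lemma left_submoduleD:
  assumes "left_submodule N"
  shows "N \<subseteq> carrier Q" "\<zero> \<in> N" "\<And>u v. u \<in> N \<Longrightarrow> v \<in> N \<Longrightarrow> u \<oplus> v \<in> N"
    "\<And>r u. r \<in> carrier R \<Longrightarrow> u \<in> N \<Longrightarrow> \<eta> r \<otimes> u \<in> N"
    "\<And>u v. u \<in> N \<Longrightarrow> v \<in> N \<Longrightarrow> u \<ominus> v \<in> N"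
proof -
  show N: "N \<subseteq> carrier Q" "\<zero> \<in> N" "\<And>u v. u \<in> N \<Longrightarrow> v \<in> N \<Longrightarrow> u \<oplus> v \<in> N"
    "\<And>r u. r \<in> carrier R \<Longrightarrow> u \<in> N \<Longrightarrow> \<eta> r \<otimes> u \<in> N"
    using assms by (auto simp: left_submodule_def)
  fix u v assume uv: "u \<in> N" "v \<in> N"
  then have "\<eta> (\<ominus>\<^bsub>R\<^esub> \<one>\<^bsub>R\<^esub>) \<otimes> v = \<ominus> v" using N(1) by (auto simp: S.l_minus)
  then have "\<ominus> v \<in> N" using N(4)[of "\<ominus>\<^bsub>R\<^esub> \<one>\<^bsub>R\<^esub>" v] uv by simp
  then show "u \<ominus> v \<in> N" using N(3) uv by (simp add: S.minus_eq)
qed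

lemma left_submodule_left_ideal: "left_ideal I Q \<Longrightarrow> left_submodule I"
  using left_idealD[of I Q] by (auto simp: left_submodule_def)

lemma left_submodule_Int:
  "left_submodule M \<Longrightarrow> left_submodule N \<Longrightarrow> left_submodule (M \<inter> N)"
  by (auto simp: left_submodule_def)

lemma adjoinI: "r \<in> carrier R \<Longrightarrow> m \<in> M \<Longrightarrow> \<eta> r \<otimes> u \<oplus> m \<in> adjoin u M"
  by (auto simp: adjoin_def)

lemma left_submodule_adjoin:
  assumes u: "u \<in> carrier Q" and M: "left_submodule M"
  shows "left_submodule (adjoin u M)"
  unfolding left_submodule_def
proof (intro conjI ballI)
  note M' = left_submoduleD[OF M]
  note [simp] = subsetD[OF M'(1)]
  show "adjoin u M \<subseteq> carrier Q" using u by (auto simp: adjoin_def)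
  show "\<zero> \<in> adjoin u M" using u adjoinI[OF R.zero_closed M'(2), of u] by simp
next
  note M' = left_submoduleD[OF M]
  note [simp] = subsetD[OF M'(1)]
  fix v w assume "v \<in> adjoin u M" "w \<in> adjoin u M"
  then obtain r m s n where *: "r \<in> carrier R" "m \<in> M" "s \<in> carrier R" "n \<in> M"
    and vw: "v = \<eta> r \<otimes> u \<oplus> m" "w = \<eta> s \<otimes> u \<oplus> n"
    by (auto simp: adjoin_def)
  have "v \<oplus> w = \<eta> (r \<oplus>\<^bsub>R\<^esub> s) \<otimes> u \<oplus> (m \<oplus> n)"
    using * u by (simp add: vw S.l_distr S.a_ac)
  then show "v \<oplus> w \<in> adjoin u M"
    using adjoinI[of "r \<oplus>\<^bsub>R\<^esub> s" "m \<oplus> n" M u] * M'(3) by simp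
next
  note M' = left_submoduleD[OF M]
  note [simp] = subsetD[OF M'(1)]
  fix t v assume t: "t \<in> carrier R" and "v \<in> adjoin u M"
  then obtain r m where *: "r \<in> carrier R" "m \<in> M" and v: "v = \<eta> r \<otimes> u \<oplus> m"
    by (auto simp: adjoin_def)
  have "\<eta> t \<otimes> v = \<eta> (t \<otimes>\<^bsub>R\<^esub> r) \<otimes> u \<oplus> \<eta> t \<otimes> m"
    using * u t by (simp add: v S.r_distr S.m_assoc)
  then show "\<eta> t \<otimes> v \<in> adjoin u M"
    using adjoinI[of "t \<otimes>\<^bsub>R\<^esub> r" "\<eta> t \<otimes> m" M u] * t M'(4) by simp
qed

lemma adjoin_increasing:
  assumes "u \<in> carrier Q" "M \<subseteq> carrier Q"
  shows "M \<subseteq> adjoin u M"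
proof
  fix m assume m: "m \<in> M"
  then have "\<eta> \<zero>\<^bsub>R\<^esub> \<otimes> u \<oplus> m = m" using assms by auto
  then show "m \<in> adjoin u M" using adjoinI[OF R.zero_closed m, of u] by simp
qed

lemma multiple_in_adjoin:
  assumes "u \<in> carrier Q" "left_submodule M" "r \<in> carrier R"
  shows "\<eta> r \<otimes> u \<in> adjoin u M"
  using adjoinI[OF assms(3) left_submoduleD(2)[OF assms(2)], of u] assms by simp

lemma adjoin_commute:
  assumes "u \<in> carrier Q" "v \<in> carrier Q" "M \<subseteq> carrier Q"
  shows "adjoin u (adjoin v M) = adjoin v (adjoin u M)"
proof -
  have "adjoin u (adjoin v M) \<subseteq> adjoin v (adjoin u M)"
    if "u \<in> carrier Q" "v \<in> carrier Q" for u v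
  proof
    fix w assume "w \<in> adjoin u (adjoin v M)"
    then obtain r s m where *: "r \<in> carrier R" "s \<in> carrier R" "m \<in> M"
      and w: "w = \<eta> r \<otimes> u \<oplus> (\<eta> s \<otimes> v \<oplus> m)"
      by (auto simp: adjoin_def)
    have "w = \<eta> s \<otimes> v \<oplus> (\<eta> r \<otimes> u \<oplus> m)"
      using that * assms(3) by (auto simp: w S.a_lcomm)
    then show "w \<in> adjoin v (adjoin u M)" using * by (simp add: adjoinI)
  qed
  with assms show ?thesis by (intro equalityI)
qed

lemma left_ideal_leading_coeffs:
  assumes u: "u \<in> carrier Q" and M: "left_submodule M" and N: "left_submodule N"
  shows "left_ideal (leading_coeffs u M N) R"
proof (rule left_idealI[OF R.ring_axioms])
  note [simp] = subsetD[OF left_submoduleD(1)[OF M]]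
  show "leading_coeffs u M N \<subseteq> carrier R" by (auto simp: leading_coeffs_def)
  show "\<zero>\<^bsub>R\<^esub> \<in> leading_coeffs u M N"
    using u left_submoduleD(2)[OF M] left_submoduleD(2)[OF N]
    by (auto simp: leading_coeffs_def intro!: bexI[of _ \<zero>])
next
  note [simp] = subsetD[OF left_submoduleD(1)[OF M]]
  fix r s assume "r \<in> leading_coeffs u M N" "s \<in> leading_coeffs u M N"
  then obtain m n where *: "r \<in> carrier R" "s \<in> carrier R" "m \<in> M" "n \<in> M"
      "\<eta> r \<otimes> u \<oplus> m \<in> N" "\<eta> s \<otimes> u \<oplus> n \<in> N"
    by (auto simp: leading_coeffs_def)
  have "(\<eta> r \<otimes> u \<oplus> m) \<oplus> (\<eta> s \<otimes> u \<oplus> n) = \<eta> (r \<oplus>\<^bsub>R\<^esub> s) \<otimes> u \<oplus> (m \<oplus> n)"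
    using * u by (simp add: S.l_distr S.a_ac)
  then show "r \<oplus>\<^bsub>R\<^esub> s \<in> leading_coeffs u M N"
    using * left_submoduleD(3)[OF N *(5,6)] left_submoduleD(3)[OF M *(3,4)]
    unfolding leading_coeffs_def
    by (intro CollectI conjI bexI[of _ "m \<oplus> n"]) simp_all
next
  note [simp] = subsetD[OF left_submoduleD(1)[OF M]]
  fix t r assume t: "t \<in> carrier R" and "r \<in> leading_coeffs u M N"
  then obtain m where *: "r \<in> carrier R" "m \<in> M" "\<eta> r \<otimes> u \<oplus> m \<in> N"
    by (auto simp: leading_coeffs_def)
  have "\<eta> t \<otimes> (\<eta> r \<otimes> u \<oplus> m) = \<eta> (t \<otimes>\<^bsub>R\<^esub> r) \<otimes> u \<oplus> \<eta> t \<otimes> m"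
    using * u t by (simp add: S.r_distr S.m_assoc)
  then show "t \<otimes>\<^bsub>R\<^esub> r \<in> leading_coeffs u M N"
    using * t left_submoduleD(4)[OF N t *(3)] left_submoduleD(4)[OF M t *(2)]
    unfolding leading_coeffs_def
    by (intro CollectI conjI bexI[of _ "\<eta> t \<otimes> m"]) simp_all
qed

lemma noetherian_submodule_zero: "noetherian_submodule {\<zero>}"
  unfolding noetherian_submodule_def
  by (intro allI impI exI[of _ "{}"]) (auto simp: left_submodule_def)

text \<open>
  A submodule \<open>N\<close> of \<open>R u + M\<close> is an extension of its left ideal of \<open>u\<close>-coefficients by
  \<open>N \<inter> M\<close>. Generators of \<open>N \<inter> M\<close> and lifts to \<open>N\<close> of generators of the ideal together generate \<open>N\<close>.
\<close>
lemma noetherian_submodule_adjoin: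
  assumes noeth: "left_noetherian R" and u: "u \<in> carrier Q"
    and M: "left_submodule M" "noetherian_submodule M"
  shows "noetherian_submodule (adjoin u M)"
  unfolding noetherian_submodule_def
proof (intro allI impI, elim conjE)
  fix N assume N: "left_submodule N" "N \<subseteq> adjoin u M"
  obtain S where S: "finite S" "S \<subseteq> leading_coeffs u M N"
      "\<And>J. left_ideal J R \<Longrightarrow> S \<subseteq> J \<Longrightarrow> leading_coeffs u M N \<subseteq> J"
    using left_noetherian_generators[OF noeth left_ideal_leading_coeffs[OF u M(1) N(1)]] by metis
  have "\<forall>s\<in>S. \<exists>m. m \<in> M \<and> \<eta> s \<otimes> u \<oplus> m \<in> N"
    using S(2) by (auto simp: leading_coeffs_def)
  then obtain tail where tail: "\<And>s. s \<in> S \<Longrightarrow> tail s \<in> M \<and> \<eta> s \<otimes> u \<oplus> tail s \<in> N"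
    by metis
  obtain G where G: "finite G" "G \<subseteq> N \<inter> M"
      "\<And>N'. left_submodule N' \<Longrightarrow> G \<subseteq> N' \<Longrightarrow> N \<inter> M \<subseteq> N'"
    using M(2) left_submodule_Int[OF N(1) M(1)] unfolding noetherian_submodule_def
    by (metis inf_le2)
  let ?H = "G \<union> (\<lambda>s. \<eta> s \<otimes> u \<oplus> tail s) ` S"
  show "\<exists>H. finite H \<and> H \<subseteq> N \<and> (\<forall>N'. left_submodule N' \<and> H \<subseteq> N' \<longrightarrow> N \<subseteq> N')"
  proof (intro exI[of _ ?H] conjI allI impI)
    show "finite ?H" using G(1) S(1) by simp
    show "?H \<subseteq> N" using G(2) tail by auto
    fix N' assume "left_submodule N' \<and> ?H \<subseteq> N'"
    then have N': "left_submodule N'" "?H \<subseteq> N'" by auto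
    \<comment> \<open>the coefficients reached inside \<open>N \<inter> N'\<close> form an ideal that contains the generators \<open>S\<close>\<close>
    have int: "left_submodule (N \<inter> N')" by (rule left_submodule_Int[OF N(1) N'(1)])
    have "S \<subseteq> leading_coeffs u M (N \<inter> N')"
      using S(2) N'(2) tail unfolding leading_coeffs_def by blast
    then have lead: "leading_coeffs u M N \<subseteq> leading_coeffs u M (N \<inter> N')"
      by (rule S(3)[OF left_ideal_leading_coeffs[OF u M(1) int]])
    show "N \<subseteq> N'"
    proof
      fix n assume n: "n \<in> N"
      obtain r m where rm: "n = \<eta> r \<otimes> u \<oplus> m" "r \<in> carrier R" "m \<in> M"
        using N(2) n by (auto simp: adjoin_def)
      then have "r \<in> leading_coeffs u M N" using n by (auto simp: leading_coeffs_def)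
      then obtain m' where m': "m' \<in> M" "\<eta> r \<otimes> u \<oplus> m' \<in> N \<inter> N'"
        using lead by (auto simp: leading_coeffs_def)
      have cl: "m \<in> carrier Q" "m' \<in> carrier Q" "n \<in> carrier Q"
        using rm(3) m'(1) n left_submoduleD(1)[OF M(1)] left_submoduleD(1)[OF N(1)] by auto
      let ?n' = "\<eta> r \<otimes> u \<oplus> m'"
      have "n \<ominus> ?n' = m \<ominus> m'" using rm u cl by (simp add: S.minus_cancel_left)
      then have "n \<ominus> ?n' \<in> N \<inter> M"
        using left_submoduleD(5)[OF N(1) n] left_submoduleD(5)[OF M(1) rm(3)] m'
        by (metis IntD1 IntI)
      then have "n \<ominus> ?n' \<in> N'" using G(3)[OF N'(1)] N'(2) by auto
      then have "(n \<ominus> ?n') \<oplus> ?n' \<in> N'" using left_submoduleD(3)[OF N'(1)] m'(2) by blast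
      then show "n \<in> N'" using cl u rm(2) by (simp add: S.minus_eq S.a_assoc S.l_neg)
    qed
  qed
qed

end


section \<open>Alternating words\<close>

text \<open>
  What the proof uses of the amalgamated product: \<open>Q\<close> is generated as a ring by the image of \<open>R\<close>
  and two letters that satisfy skew commutation rules and quadratic relations. The letters are
  indexed by a boolean so that each argument covers both at once.
\<close>

locale alternating_extension = ring_over R Q \<eta>
  for R :: "('r, 'm) ring_scheme" and Q :: "('q, 'n) ring_scheme" (structure)
    and \<eta> :: "'r \<Rightarrow> 'q" +
  fixes z :: "bool \<Rightarrow> 'q" and \<tau> :: "bool \<Rightarrow> 'r \<Rightarrow> 'r"
  assumes z_closed [simp]: "z b \<in> carrier Q"
    and aut: "\<tau> b \<in> ring_iso R R"
    and skew: "r \<in> carrier R \<Longrightarrow> \<exists>d\<in>carrier R. z b \<otimes> \<eta> r = \<eta> (\<tau> b r) \<otimes> z b \<oplus> \<eta> d"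
    and square: "\<exists>a\<in>carrier R. \<exists>c\<in>carrier R. z b \<otimes> z b = \<eta> a \<otimes> z b \<oplus> \<eta> c"
    and generates: "subring U Q \<Longrightarrow> \<eta> ` carrier R \<subseteq> U \<Longrightarrow> range z \<subseteq> U \<Longrightarrow> carrier Q \<subseteq> U"
begin

lemma tau_closed [simp]: "r \<in> carrier R \<Longrightarrow> \<tau> b r \<in> carrier R"
  using ring_iso_memE(1)[OF aut] .

text \<open>
  The alternating word that begins with \<open>z b\<close>. Its length is \<open>n + 1\<close>, so that there are two words
  for every index; the empty word would belong to both letters.
\<close>
primrec word :: "bool \<Rightarrow> nat \<Rightarrow> 'q" where
  "word b 0 = z b"
| "word b (Suc n) = z b \<otimes> word (\<not> b) n"

primrec degree_le :: "nat \<Rightarrow> 'q set" where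
  "degree_le 0 = adjoin \<one> {\<zero>}"
| "degree_le (Suc n) = adjoin (word True n) (adjoin (word False n) (degree_le n))"

text \<open>
  The unfolded form of a filtration step fixes an order of the two words, while most
  arguments need the word beginning with a given letter in front; see \<open>degree_le_Suc\<close> below.
\<close>
declare degree_le.simps(2) [simp del]

text \<open>
  Moving a scalar \<open>r\<close> from the right of \<open>word b n\<close> to its left turns it, up to lower terms, into the
  composite of the \<open>\<tau>\<close> of all letters applied to \<open>r\<close>. This is that composite without the factor
  of the last letter, which the words obtained from each other by left multiplication share.
\<close>
primrec twist :: "bool \<Rightarrow> nat \<Rightarrow> 'r \<Rightarrow> 'r" where
  "twist b 0 = (\<lambda>r. r)"
| "twist b (Suc n) = (\<lambda>r. \<tau> b (twist (\<not> b) n r))"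

lemma word_closed [simp]: "word b n \<in> carrier Q"
  by (induction n arbitrary: b) auto

lemma left_submodule_degree_le: "left_submodule (degree_le n)"
proof (induction n)
  case 0
  have "left_submodule {\<zero>}" by (auto simp: left_submodule_def)
  then show ?case by (simp add: left_submodule_adjoin)
qed (simp add: degree_le.simps(2) left_submodule_adjoin)

lemma degree_le_carrier: "degree_le n \<subseteq> carrier Q"
  by (rule left_submoduleD(1)[OF left_submodule_degree_le])

lemma degree_le_Suc:
  "degree_le (Suc n) = adjoin (word b n) (adjoin (word (\<not> b) n) (degree_le n))"
  using adjoin_commute[of "word True n" "word False n" "degree_le n"] degree_le_carrier
  by (cases b) (simp_all add: degree_le.simps(2))

lemma left_submodule_tails: "left_submodule (adjoin (word b n) (degree_le n))"
  by (simp add: left_submodule_adjoin left_submodule_degree_le)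

lemma tails_subset: "adjoin (word b n) (degree_le n) \<subseteq> degree_le (Suc n)"
  using adjoin_increasing[of "word (\<not> b) n" "adjoin (word b n) (degree_le n)"]
    left_submoduleD(1)[OF left_submodule_tails[of b n]]
  by (subst degree_le_Suc[of n "\<not> b"]) simp

lemma degree_le_subset_tails: "degree_le n \<subseteq> adjoin (word b n) (degree_le n)"
  by (simp add: adjoin_increasing degree_le_carrier)

lemma degree_le_mono: "degree_le n \<subseteq> degree_le (Suc n)"
  using degree_le_subset_tails tails_subset by blast

lemma multiple_word_in_tails:
  "r \<in> carrier R \<Longrightarrow> \<eta> r \<otimes> word b n \<in> adjoin (word b n) (degree_le n)"
  by (rule multiple_in_adjoin[OF word_closed left_submodule_degree_le])

lemma base_in_degree_le: "r \<in> carrier R \<Longrightarrow> \<eta> r \<in> degree_le n"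
proof (induction n)
  case 0
  then show ?case by (auto simp: adjoin_def intro!: exI[of _ r])
qed (use degree_le_mono in blast)

text \<open>
  This is where the quadratic relation enters: repeating the first letter of a word does not
  increase its length.
\<close>
lemma letter_word_same: "z b \<otimes> word b n \<in> degree_le (Suc n)"
proof -
  obtain a c where ac: "a \<in> carrier R" "c \<in> carrier R" "z b \<otimes> z b = \<eta> a \<otimes> z b \<oplus> \<eta> c"
    using square by blast
  note sub = left_submodule_degree_le
  have a_word: "\<eta> a \<otimes> word b n \<in> degree_le (Suc n)"
    using multiple_word_in_tails[OF ac(1)] tails_subset by blast
  show ?thesis
  proof (cases n)
    case 0
    then show ?thesis
      using ac(3) left_submoduleD(3)[OF sub a_word base_in_degree_le[OF ac(2)]]
      by simp
  next
    case (Suc k)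
    have "z b \<otimes> word b n = (z b \<otimes> z b) \<otimes> word (\<not> b) k"
      by (simp add: Suc S.m_assoc)
    also have "\<dots> = \<eta> a \<otimes> word b n \<oplus> \<eta> c \<otimes> word (\<not> b) k"
      using ac by (simp add: Suc S.l_distr S.m_assoc)
    finally have eq: "z b \<otimes> word b n = \<eta> a \<otimes> word b n \<oplus> \<eta> c \<otimes> word (\<not> b) k" .
    have "\<eta> c \<otimes> word (\<not> b) k \<in> degree_le n"
      using multiple_word_in_tails[OF ac(2)] tails_subset unfolding Suc by blast
    then show ?thesis
      using a_word degree_le_mono left_submoduleD(3)[OF sub] unfolding eq by blast
  qed
qed

lemma letter_multiple:
  assumes r: "r \<in> carrier R" and u: "u \<in> carrier Q" 
  obtains d where "d \<in> carrier R"
    "z b \<otimes> (\<eta> r \<otimes> u) = \<eta> (\<tau> b r) \<otimes> (z b \<otimes> u) \<oplus> \<eta> d \<otimes> u"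
proof -
  obtain d where d: "d \<in> carrier R" "z b \<otimes> \<eta> r = \<eta> (\<tau> b r) \<otimes> z b \<oplus> \<eta> d"
    using skew r by blast
  have "z b \<otimes> (\<eta> r \<otimes> u) = (z b \<otimes> \<eta> r) \<otimes> u"
    using r u by (simp add: S.m_assoc)
  also have "\<dots> = \<eta> (\<tau> b r) \<otimes> (z b \<otimes> u) \<oplus> \<eta> d \<otimes> u"
    using d r u by (simp add: S.l_distr S.m_assoc)
  finally show ?thesis using that d(1) by blast
qed

lemma letter_multiple_mem:
  assumes "left_submodule N" "r \<in> carrier R" "u \<in> N" "z b \<otimes> u \<in> N"
  shows "z b \<otimes> (\<eta> r \<otimes> u) \<in> N"
proof -
  have "u \<in> carrier Q" using assms left_submoduleD(1) by blast
  then obtain d where "d \<in> carrier R"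
      "z b \<otimes> (\<eta> r \<otimes> u) = \<eta> (\<tau> b r) \<otimes> (z b \<otimes> u) \<oplus> \<eta> d \<otimes> u"
    using letter_multiple[OF assms(2)] by metis
  then show ?thesis using assms left_submoduleD(3,4)[OF assms(1)] by simp
qed

lemma word_in_degree_le: "word b n \<in> degree_le (Suc n)"
proof -
  have "\<eta> \<one>\<^bsub>R\<^esub> \<otimes> word b n \<in> degree_le (Suc n)"
    using multiple_word_in_tails[OF R.one_closed] tails_subset by blast
  then show ?thesis by simp
qed

text \<open>
  Without the word that begins with the other letter, multiplication by \<open>z b\<close> does not raise
  the degree of the leading part. The hypothesis on lower degrees is discharged
  by \<open>letter_degree_le\<close>, whose induction uses the present statement.
\<close>
lemma letter_tail_aux:
  assumes m: "m \<in> adjoin (word b n) (degree_le n)"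
    and IH: "\<And>f. f \<in> degree_le n \<Longrightarrow> z b \<otimes> f \<in> degree_le (Suc n)"
  shows "z b \<otimes> m \<in> degree_le (Suc n)"
proof -
  obtain r f where rf: "m = \<eta> r \<otimes> word b n \<oplus> f" "r \<in> carrier R" "f \<in> degree_le n"
    using m by (auto simp: adjoin_def)
  moreover have "f \<in> carrier Q" using rf(3) degree_le_carrier by blast
  ultimately have "z b \<otimes> m = z b \<otimes> (\<eta> r \<otimes> word b n) \<oplus> z b \<otimes> f"
    by (simp add: S.r_distr)
  moreover have "z b \<otimes> (\<eta> r \<otimes> word b n) \<in> degree_le (Suc n)"
    by (rule letter_multiple_mem[OF left_submodule_degree_le rf(2) word_in_degree_le
          letter_word_same])
  ultimately show ?thesis
    using IH[OF rf(3)] left_submoduleD(3)[OF left_submodule_degree_le] by simp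
qed

lemma letter_degree_le: "f \<in> degree_le n \<Longrightarrow> z b \<otimes> f \<in> degree_le (Suc n)"
proof (induction n arbitrary: f)
  case 0
  then obtain r where r: "r \<in> carrier R" "f = \<eta> r \<otimes> \<one>" by (auto simp: adjoin_def)
  have "z b \<otimes> (\<eta> r \<otimes> \<one>) \<in> degree_le (Suc 0)"
    using r word_in_degree_le[of b 0] base_in_degree_le[OF R.one_closed, of "Suc 0"]
    by (intro letter_multiple_mem left_submodule_degree_le) simp_all
  then show ?case using r by simp
next
  case (Suc n)
  let ?w = "word (\<not> b) n"
  have "f \<in> adjoin ?w (adjoin (word b n) (degree_le n))"
    using Suc.prems by (subst (asm) degree_le_Suc[of n "\<not> b"]) simp
  then obtain r m where rm: "f = \<eta> r \<otimes> ?w \<oplus> m" "r \<in> carrier R"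
      "m \<in> adjoin (word b n) (degree_le n)"
    by (auto simp: adjoin_def)
  have "z b \<otimes> (\<eta> r \<otimes> ?w) \<in> degree_le (Suc (Suc n))"
  proof (rule letter_multiple_mem[OF left_submodule_degree_le rm(2)])
    show "?w \<in> degree_le (Suc (Suc n))" using word_in_degree_le degree_le_mono by blast
    show "z b \<otimes> ?w \<in> degree_le (Suc (Suc n))"
      using word_in_degree_le[of b "Suc n"] by simp
  qed
  moreover have "z b \<otimes> m \<in> degree_le (Suc (Suc n))"
    using letter_tail_aux[OF rm(3) Suc.IH] degree_le_mono by blast
  moreover have "m \<in> carrier Q"
    using rm(3) left_submoduleD(1)[OF left_submodule_tails] by blast
  then have "z b \<otimes> f = z b \<otimes> (\<eta> r \<otimes> ?w) \<oplus> z b \<otimes> m"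
    using rm by (simp add: S.r_distr)
  ultimately show ?case
    using left_submoduleD(3)[OF left_submodule_degree_le] by simp
qed

lemma letter_tail:
  "m \<in> adjoin (word b n) (degree_le n) \<Longrightarrow> z b \<otimes> m \<in> degree_le (Suc n)"
  by (rule letter_tail_aux[OF _ letter_degree_le])

text \<open>
  The elements of \<open>Q\<close> whose left multiplication preserves the union of the filtration form a
  subring. It contains the generators, so it is \<open>Q\<close>; applying it to \<open>1\<close> gives the claim.
\<close>
lemma carrier_eq_Union_degree_le: "carrier Q = (\<Union>n. degree_le n)"
proof
  show "(\<Union>n. degree_le n) \<subseteq> carrier Q" using degree_le_carrier by blast
  define F where "F = (\<Union>n. degree_le n)"
  have F_iff: "u \<in> F \<longleftrightarrow> (\<exists>n. u \<in> degree_le n)" for u by (simp add: F_def)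
  note mono = lift_Suc_mono_le[of degree_le, OF degree_le_mono]
  have add: "u \<oplus> v \<in> F" if uv: "u \<in> F" "v \<in> F" for u v
  proof -
    obtain m n where "u \<in> degree_le m" "v \<in> degree_le n" using uv F_iff by blast
    then have "u \<in> degree_le (max m n)" "v \<in> degree_le (max m n)"
      using mono[of m "max m n"] mono[of n "max m n"] by auto
    then show ?thesis using left_submoduleD(3)[OF left_submodule_degree_le] F_iff by blast
  qed
  have scal: "\<eta> r \<otimes> u \<in> F" if "r \<in> carrier R" "u \<in> F" for r u
    using that left_submoduleD(4)[OF left_submodule_degree_le] F_iff by blast
  have F: "F \<subseteq> carrier Q" using degree_le_carrier F_iff by blast
  have one: "\<one> \<in> F"
    using base_in_degree_le[OF R.one_closed] F_iff by simp
  let ?U = "{u \<in> carrier Q. \<forall>f\<in>F. u \<otimes> f \<in> F}"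
  have "subring ?U Q"
  proof (rule S.subringI)
    show "?U \<subseteq> carrier Q" by blast
    show "\<one> \<in> ?U" using F by (simp add: subset_iff)
  next
    fix u assume u: "u \<in> ?U"
    have "\<ominus> u \<otimes> f \<in> F" if f: "f \<in> F" for f
    proof -
      have "\<eta> (\<ominus>\<^bsub>R\<^esub> \<one>\<^bsub>R\<^esub>) \<otimes> (u \<otimes> f) \<in> F" using u f scal by blast
      moreover have "u \<in> carrier Q" "f \<in> carrier Q" using u f F by auto
      ultimately show ?thesis by (simp add: S.l_minus)
    qed
    then show "\<ominus> u \<in> ?U" using u by simp
  next
    fix u v assume uv: "u \<in> ?U" "v \<in> ?U"
    have "u \<otimes> v \<otimes> f \<in> F" if f: "f \<in> F" for f
      using uv f F S.m_assoc[of u v f] by auto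
    then show "u \<otimes> v \<in> ?U" using uv by simp
    have "(u \<oplus> v) \<otimes> f \<in> F" if f: "f \<in> F" for f
    proof -
      have "(u \<oplus> v) \<otimes> f = u \<otimes> f \<oplus> v \<otimes> f"
        using uv f F by (intro S.l_distr) auto
      moreover have "u \<otimes> f \<in> F" "v \<otimes> f \<in> F" using uv f by auto
      ultimately show ?thesis using add by simp
    qed
    then show "u \<oplus> v \<in> ?U" using uv by simp
  qed
  moreover have "\<eta> ` carrier R \<subseteq> ?U" using scal by auto
  moreover have "z b \<otimes> f \<in> F" if "f \<in> F" for b f
    using that letter_degree_le F_iff by blast
  then have "range z \<subseteq> ?U" by auto
  ultimately have U: "carrier Q \<subseteq> ?U" by (rule generates)
  show "carrier Q \<subseteq> (\<Union>n. degree_le n)"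
    unfolding F_def[symmetric]
  proof
    fix u assume u: "u \<in> carrier Q"
    then have "u \<otimes> \<one> \<in> F" using U one by blast
    then show "u \<in> F" using u by simp
  qed
qed

lemma noetherian_degree_le:
  assumes "left_noetherian R"
  shows "noetherian_submodule (degree_le n)"
proof (induction n)
  case 0
  have "left_submodule {\<zero>}" by (auto simp: left_submodule_def)
  then show ?case
    by (simp add: noetherian_submodule_adjoin assms noetherian_submodule_zero)
qed (simp add: degree_le.simps(2) noetherian_submodule_adjoin assms left_submodule_degree_le left_submodule_tails)


section \<open>Leading coefficients of a left ideal\<close>

text \<open>
  The term in the other word of the same length is counted as part of the tail: each of the two words
  has its own ideal of leading coefficients, without regard to the other coefficient.
\<close>
definition lead :: "'q set \<Rightarrow> bool \<Rightarrow> nat \<Rightarrow> 'r set" where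
  "lead I b n = leading_coeffs (word b n) (adjoin (word (\<not> b) n) (degree_le n)) I"

lemma left_ideal_lead: "left_ideal I Q \<Longrightarrow> left_ideal (lead I b n) R"
  unfolding lead_def
  by (intro left_ideal_leading_coeffs word_closed left_submodule_tails left_submodule_left_ideal)

text \<open>
  Multiplication by \<open>z b\<close> moves the word beginning with the other letter up by one degree and
  everything else into lower terms, so the product has a single leading term.
\<close>
lemma lead_lift:
  assumes I: "left_ideal I Q" and r: "r \<in> lead I (\<not> b) n"
  obtains j m where "j \<in> I \<inter> degree_le (Suc n)" "m \<in> degree_le (Suc n)"
    "z b \<otimes> j = \<eta> (\<tau> b r) \<otimes> word b (Suc n) \<oplus> m"
proof -
  let ?w = "word (\<not> b) n"
  obtain m where m: "r \<in> carrier R" "m \<in> adjoin (word b n) (degree_le n)"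
      "\<eta> r \<otimes> ?w \<oplus> m \<in> I"
    using r by (auto simp: lead_def leading_coeffs_def)
  have "\<eta> r \<otimes> ?w \<oplus> m \<in> degree_le (Suc n)"
    using m by (subst degree_le_Suc[of n "\<not> b"]) (simp add: adjoinI)
  with m have j: "\<eta> r \<otimes> ?w \<oplus> m \<in> I \<inter> degree_le (Suc n)" by simp
  obtain d where d: "d \<in> carrier R"
      "z b \<otimes> (\<eta> r \<otimes> ?w) = \<eta> (\<tau> b r) \<otimes> (z b \<otimes> ?w) \<oplus> \<eta> d \<otimes> ?w"
    using letter_multiple[OF m(1) word_closed] by metis
  have mc: "m \<in> carrier Q" using m(2) left_submoduleD(1)[OF left_submodule_tails] by blast
  have "z b \<otimes> (\<eta> r \<otimes> ?w \<oplus> m) = z b \<otimes> (\<eta> r \<otimes> ?w) \<oplus> z b \<otimes> m"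
    using m(1) mc by (simp add: S.r_distr)
  also have "\<dots> = \<eta> (\<tau> b r) \<otimes> word b (Suc n) \<oplus> (\<eta> d \<otimes> ?w \<oplus> z b \<otimes> m)"
    using d m(1) mc by (simp add: S.a_assoc)
  finally have eq: "z b \<otimes> (\<eta> r \<otimes> ?w \<oplus> m) =
      \<eta> (\<tau> b r) \<otimes> word b (Suc n) \<oplus> (\<eta> d \<otimes> ?w \<oplus> z b \<otimes> m)" .
  have "\<eta> d \<otimes> ?w \<in> degree_le (Suc n)"
    using multiple_word_in_tails[OF d(1)] tails_subset by blast
  then have "\<eta> d \<otimes> ?w \<oplus> z b \<otimes> m \<in> degree_le (Suc n)"
    using letter_tail[OF m(2)] by (rule left_submoduleD(3)[OF left_submodule_degree_le])
  from that[OF j this eq] show thesis .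
qed

lemma lead_Suc:
  assumes I: "left_ideal I Q" and r: "r \<in> lead I (\<not> b) n"
  shows "\<tau> b r \<in> lead I b (Suc n)"
proof -
  obtain j m where jm: "j \<in> I \<inter> degree_le (Suc n)" "m \<in> degree_le (Suc n)"
      "z b \<otimes> j = \<eta> (\<tau> b r) \<otimes> word b (Suc n) \<oplus> m"
    using lead_lift[OF assms] by metis
  have "z b \<otimes> j \<in> I" using jm(1) left_idealD(4)[OF I] by simp
  moreover have "m \<in> adjoin (word (\<not> b) (Suc n)) (degree_le (Suc n))"
    using degree_le_subset_tails jm(2) by blast
  moreover have "r \<in> carrier R" using r by (simp add: lead_def leading_coeffs_def)
  ultimately show ?thesis
    unfolding lead_def leading_coeffs_def using jm(3) by auto
qed

lemma twist_iso: "twist b n \<in> ring_iso R R"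
proof (induction n arbitrary: b)
  case 0
  show ?case using ring_iso_set_refl[of R] by (simp add: id_def)
next
  case (Suc n)
  show ?case using ring_iso_set_trans[OF Suc aut] by (simp add: comp_def)
qed

lemma twist_bij: "bij_betw (twist b n) (carrier R) (carrier R)"
  using ring_iso_memE(5)[OF twist_iso] .

text \<open>
  Pulling the ideals of leading coefficients back along \<open>twist\<close> turns \<open>lead_Suc\<close> into an inclusion
  of the ideal for \<open>\<not> b\<close> in degree \<open>n\<close> into the ideal for \<open>b\<close> in the next degree. The
  first letter thus alternates with the degree, and there are two interlaced ascending chains.
  Once both are stationary, surjectivity of the twists turns equality of the pulled back
  ideals into the reverse of the inclusion in \<open>lead_Suc\<close>.
\<close>
lemma lead_eventually_shift:
  assumes noeth: "left_noetherian R" and I: "left_ideal I Q"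
  shows "\<exists>N. \<forall>n\<ge>N. \<forall>b. lead I b (Suc n) \<subseteq> \<tau> b ` lead I (\<not> b) n"
proof -
  define untwisted where
    "untwisted b n = {r \<in> carrier R. twist b n r \<in> lead I b n}" for b n
  have ideal: "left_ideal (untwisted b n) R" for b n
  proof (rule left_idealI[OF R.ring_axioms])
    interpret t: ring_hom_ring R R "twist b n"
      using twist_iso by (intro ring_hom_ringI2 R.ring_axioms) (simp add: ring_iso_def)
    note J = left_idealD[OF left_ideal_lead[OF I]]
    show "untwisted b n \<subseteq> carrier R" by (auto simp: untwisted_def)
    show "\<zero>\<^bsub>R\<^esub> \<in> untwisted b n" using J(2) by (simp add: untwisted_def)
    show "r \<oplus>\<^bsub>R\<^esub> s \<in> untwisted b n" if "r \<in> untwisted b n" "s \<in> untwisted b n" for r s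
      using that J(3) by (simp add: untwisted_def)
    show "r \<otimes>\<^bsub>R\<^esub> s \<in> untwisted b n" if "r \<in> carrier R" "s \<in> untwisted b n" for r s
      using that J(4) by (simp add: untwisted_def)
  qed
  have step: "untwisted (\<not> b) n \<subseteq> untwisted b (Suc n)" for b n
    using lead_Suc[OF I] by (auto simp: untwisted_def)
  \<comment> \<open>the parity condition makes the first letter alternate along each of the two chains\<close>
  define chain where "chain b n = untwisted (b = even n) n" for b n
  have "\<exists>N. \<forall>n\<ge>N. chain b n = chain b N" for b
  proof (rule left_noetherian_chain_stabilizes[OF noeth])
    show "chain b n \<subseteq> chain b (Suc n)" for n
      using step[of "b = even (Suc n)" n] by (simp add: chain_def)
  qed (simp add: chain_def ideal)
  then obtain N where N: "\<And>b n. n \<ge> N b \<Longrightarrow> chain b n = chain b (N b)" by metis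
  have "lead I b (Suc n) \<subseteq> \<tau> b ` lead I (\<not> b) n" if n: "n \<ge> max (N True) (N False)" for b n
  proof
    fix r assume r: "r \<in> lead I b (Suc n)"
    \<comment> \<open>the chain that passes through the letter \<open>b\<close> in step \<open>Suc n\<close>\<close>
    let ?b = "b = even (Suc n)"
    have "n \<ge> N t" for t using n by (cases t) auto
    then have "n \<ge> N ?b" .
    then have "chain ?b (Suc n) = chain ?b n" using N[of ?b n] N[of ?b "Suc n"] by simp
    moreover have "(?b = even (Suc n)) = b" "(?b = even n) = (\<not> b)" by auto
    ultimately have eq: "untwisted b (Suc n) = untwisted (\<not> b) n"
      by (simp only: chain_def)
    have "r \<in> carrier R" using r by (simp add: lead_def leading_coeffs_def)
    then obtain s where s: "s \<in> carrier R" "r = twist b (Suc n) s"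
      using twist_bij[of b "Suc n"] unfolding bij_betw_def by blast
    then have "s \<in> untwisted b (Suc n)" using r by (simp add: untwisted_def)
    then have "twist (\<not> b) n s \<in> lead I (\<not> b) n" unfolding eq by (simp add: untwisted_def)
    then show "r \<in> \<tau> b ` lead I (\<not> b) n" using s(2) by simp
  qed
  then show ?thesis by blast
qed

text \<open>
  With \<open>N\<close> the degree from which on the leading coefficients shift, the generators
  of the \<open>R\<close>-module \<open>I \<inter> degree_le (Suc N)\<close> generate \<open>I\<close>: by induction on the degree, the two leading terms of an
  element of \<open>I\<close> are matched by \<open>z True\<close> and \<open>z False\<close> times elements of \<open>I\<close> of smaller degree.
\<close>
theorem left_noetherian_extension:
  assumes noeth: "left_noetherian R"
  shows "left_noetherian Q"
proof (rule left_noetherianI[OF S.ring_axioms])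
  fix I assume I: "left_ideal I Q"
  obtain N where N: "\<And>n b. n \<ge> N \<Longrightarrow> lead I b (Suc n) \<subseteq> \<tau> b ` lead I (\<not> b) n"
    using lead_eventually_shift[OF noeth I] by blast
  have subm: "left_submodule (I \<inter> degree_le (Suc N))"
    by (intro left_submodule_Int left_submodule_left_ideal I left_submodule_degree_le)
  then obtain G where G: "finite G" "G \<subseteq> I \<inter> degree_le (Suc N)"
      "\<And>J. left_submodule J \<Longrightarrow> G \<subseteq> J \<Longrightarrow> I \<inter> degree_le (Suc N) \<subseteq> J"
    using noetherian_degree_le[OF noeth, of "Suc N"] unfolding noetherian_submodule_def
    by (metis inf_le2)
  have "I \<subseteq> J" if J: "left_ideal J Q" "G \<subseteq> J" for J
  proof -
    note sub = left_submodule_degree_le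
    have low: "I \<inter> degree_le (Suc n) \<subseteq> J" if "n \<ge> N" for n
      using that
    proof (induction n rule: dec_induct)
      case base
      show ?case by (rule G(3)[OF left_submodule_left_ideal[OF J(1)] J(2)])
    next
      case (step n)
      show ?case
      proof
        fix i assume i: "i \<in> I \<inter> degree_le (Suc (Suc n))"
        let ?w = "\<lambda>b. word b (Suc n)"
        obtain r s f where rsf: "i = \<eta> r \<otimes> ?w True \<oplus> (\<eta> s \<otimes> ?w False \<oplus> f)"
            "r \<in> carrier R" "s \<in> carrier R" "f \<in> degree_le (Suc n)"
          using i unfolding degree_le.simps(2)[of "Suc n"] adjoin_def by blast
        have fc: "f \<in> carrier Q" using rsf(4) degree_le_carrier by blast
        have "r \<in> lead I True (Suc n)"
          unfolding lead_def leading_coeffs_def using i rsf by (auto intro: adjoinI)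
        moreover have "i = \<eta> s \<otimes> ?w False \<oplus> (\<eta> r \<otimes> ?w True \<oplus> f)"
          using rsf fc by (simp add: S.a_lcomm)
        then have "s \<in> lead I False (Suc n)"
          unfolding lead_def leading_coeffs_def using i rsf by (auto intro: adjoinI)
        ultimately obtain r' s' where rs': "r' \<in> lead I (\<not> True) n" "r = \<tau> True r'"
            "s' \<in> lead I (\<not> False) n" "s = \<tau> False s'"
          using N[OF step(1)] by blast
        obtain j m where j: "j \<in> I \<inter> degree_le (Suc n)" "m \<in> degree_le (Suc n)"
            "z True \<otimes> j = \<eta> r \<otimes> ?w True \<oplus> m"
          using lead_lift[OF I rs'(1)] rs'(2) by metis
        obtain k l where k: "k \<in> I \<inter> degree_le (Suc n)" "l \<in> degree_le (Suc n)"
            "z False \<otimes> k = \<eta> s \<otimes> ?w False \<oplus> l"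
          using lead_lift[OF I rs'(3)] rs'(4) by metis
        \<comment> \<open>an element of \<open>J\<close> with the same two leading terms as \<open>i\<close>\<close>
        let ?q = "z True \<otimes> j \<oplus> z False \<otimes> k"
        have qI: "?q \<in> I" using j(1) k(1) left_idealD(3,4)[OF I] by simp
        have qJ: "?q \<in> J" using j(1) k(1) step.IH left_idealD(3,4)[OF J(1)] by (simp add: subset_iff)
        have lm: "l \<in> carrier Q" "m \<in> carrier Q" using j(2) k(2) degree_le_carrier by auto
        have cl: "i \<in> carrier Q" "?q \<in> carrier Q" using i qI left_idealD(1)[OF I] by auto
        have "i = (\<eta> r \<otimes> ?w True \<oplus> \<eta> s \<otimes> ?w False) \<oplus> f"
          using rsf fc by (simp add: S.a_assoc del: word.simps)
        moreover have "?q = (\<eta> r \<otimes> ?w True \<oplus> \<eta> s \<otimes> ?w False) \<oplus> (m \<oplus> l)"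
          using j(3) k(3) rsf lm by (simp add: S.a_ac del: word.simps)
        ultimately have "i \<ominus> ?q = f \<ominus> (m \<oplus> l)"
          using S.minus_cancel_left[of "\<eta> r \<otimes> ?w True \<oplus> \<eta> s \<otimes> ?w False" f "m \<oplus> l"] rsf(2,3) fc lm
          by (simp del: word.simps)
        then have "i \<ominus> ?q \<in> degree_le (Suc n)"
          using left_submoduleD(5)[OF sub rsf(4) left_submoduleD(3)[OF sub j(2) k(2)]] by simp
        moreover have "i \<ominus> ?q \<in> I"
          using left_submoduleD(5)[OF left_submodule_left_ideal[OF I]] i qI by blast
        ultimately have "i \<ominus> ?q \<in> J" using step.IH by blast
        then have "(i \<ominus> ?q) \<oplus> ?q \<in> J" using qJ left_idealD(3)[OF J(1)] by blast
        then show "i \<in> J" using cl by (simp add: S.minus_eq S.a_assoc S.l_neg)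
      qed
    qed
    show ?thesis
    proof
      fix i assume i: "i \<in> I"
      then obtain n where "i \<in> degree_le n"
        using left_idealD(1)[OF I] carrier_eq_Union_degree_le by blast
      then have "i \<in> degree_le (Suc (max n N))"
        using lift_Suc_mono_le[of degree_le, OF degree_le_mono, of n "Suc (max n N)"] le_SucI[OF max.cobounded1, of n N]
        by blast
      then show "i \<in> J" using low[of "max n N"] i by auto
    qed
  qed
  then show "\<exists>S. finite S \<and> S \<subseteq> I \<and> (\<forall>J. left_ideal J Q \<and> S \<subseteq> J \<longrightarrow> I \<subseteq> J)"
    using G(1,2) by (intro exI[of _ G]) simp
qed

end


section \<open>Passing to the opposite ring\<close>

definition opposite :: "('a, 'm) ring_scheme \<Rightarrow> ('a, 'm) ring_scheme" where
  "opposite R = R\<lparr>monoid.mult := \<lambda>u v. v \<otimes>\<^bsub>R\<^esub> u\<rparr>"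

lemma opposite_simps [simp]:
  "carrier (opposite R) = carrier R" "\<one>\<^bsub>opposite R\<^esub> = \<one>\<^bsub>R\<^esub>" "\<zero>\<^bsub>opposite R\<^esub> = \<zero>\<^bsub>R\<^esub>"
  "u \<otimes>\<^bsub>opposite R\<^esub> v = v \<otimes>\<^bsub>R\<^esub> u" "(\<oplus>\<^bsub>opposite R\<^esub>) = (\<oplus>\<^bsub>R\<^esub>)"
  by (simp_all add: opposite_def)

lemma opposite_opposite [simp]: "opposite (opposite R) = R"
  by (simp add: opposite_def)

lemma ring_opposite: "ring R \<Longrightarrow> ring (opposite R)"
proof -
  assume "ring R"
  then interpret ring R .
  show ?thesis
  proof (rule ringI)
    show "abelian_group (opposite R)"
      by (rule abelian_groupI) (auto simp: a_ac intro: bexI[of _ "\<ominus>\<^bsub>R\<^esub> _"] l_neg)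
    show "monoid (opposite R)" by (rule monoidI) (auto simp: m_assoc)
  qed (auto simp: l_distr r_distr)
qed

lemma left_ideal_opposite: "left_ideal I (opposite R) \<longleftrightarrow> right_ideal I R"
  by (simp add: left_ideal_def right_ideal_def additive_subgroup_def)

lemma left_noetherian_opposite: "left_noetherian (opposite R) \<longleftrightarrow> right_noetherian R"
  using ring_opposite[of R] ring_opposite[of "opposite R"]
  by (auto simp: left_noetherian_def right_noetherian_def left_ideal_opposite
      genleftideal_def genrightideal_def)

lemma ring_hom_opposite: "f \<in> ring_hom R S \<Longrightarrow> f \<in> ring_hom (opposite R) (opposite S)"
  by (auto simp: ring_hom_def)

lemma ring_iso_opposite: "f \<in> ring_iso R S \<Longrightarrow> f \<in> ring_iso (opposite R) (opposite S)"
  by (auto simp: ring_iso_def ring_hom_opposite)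

lemma subring_opposite:
  assumes "ring Q" "subring U (opposite Q)" shows "subring U Q"
  using subringE[OF assms(2)] assms(1)
  by (intro ring.subringI) (auto simp: a_inv_def)

context alternating_extension
begin

abbreviation tau_inv :: "bool \<Rightarrow> 'r \<Rightarrow> 'r" where
  "tau_inv b \<equiv> inv_into (carrier R) (\<tau> b)"

lemma tau_inv_iso: "tau_inv b \<in> ring_iso R R"
  by (rule ring_iso_set_sym[OF R.ring_axioms aut])

lemma tau_inv_closed [simp]: "r \<in> carrier R \<Longrightarrow> tau_inv b r \<in> carrier R"
  using ring_iso_memE(1)[OF tau_inv_iso] .

lemma tau_tau_inv: "r \<in> carrier R \<Longrightarrow> \<tau> b (tau_inv b r) = r"
  using ring_iso_memE(5)[OF aut[of b]] by (simp add: bij_betw_inv_into_right)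

lemma skew_right:
  assumes r: "r \<in> carrier R"
  shows "\<exists>d\<in>carrier R. \<eta> r \<otimes> z b = z b \<otimes> \<eta> (tau_inv b r) \<oplus> \<eta> d"
proof -
  obtain d where d: "d \<in> carrier R" "z b \<otimes> \<eta> (tau_inv b r) = \<eta> r \<otimes> z b \<oplus> \<eta> d"
    using skew[OF tau_inv_closed[OF r]] tau_tau_inv[OF r] by metis
  then have "\<eta> r \<otimes> z b = z b \<otimes> \<eta> (tau_inv b r) \<oplus> \<eta> (\<ominus>\<^bsub>R\<^esub> d)"
    using r by (simp add: S.a_assoc S.r_neg)
  then show ?thesis using d(1) by (intro bexI[of _ "\<ominus>\<^bsub>R\<^esub> d"]) simp_all
qed

text \<open>
  The coefficient of \<open>z b\<close> in the quadratic relation has to be moved to the right of \<open>z b\<close>, which by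
  \<open>skew_right\<close> only changes the constant term.
\<close>
lemma alternating_extension_opposite:
  "alternating_extension (opposite R) (opposite Q) \<eta> z tau_inv"
proof -
  interpret op: ring_hom_ring "opposite R" "opposite Q" \<eta>
    by (intro ring_hom_ringI2 ring_opposite R.ring_axioms S.ring_axioms ring_hom_opposite homh)
  show ?thesis
  proof
    show "z b \<in> carrier (opposite Q)" for b by simp
    show "tau_inv b \<in> ring_iso (opposite R) (opposite R)" for b
      by (rule ring_iso_opposite[OF tau_inv_iso])
    show "\<exists>d\<in>carrier (opposite R). z b \<otimes>\<^bsub>opposite Q\<^esub> \<eta> r =
        \<eta> (tau_inv b r) \<otimes>\<^bsub>opposite Q\<^esub> z b \<oplus>\<^bsub>opposite Q\<^esub> \<eta> d"
      if "r \<in> carrier (opposite R)" for r b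
      using skew_right that by simp
    show "\<exists>a\<in>carrier (opposite R). \<exists>c\<in>carrier (opposite R). z b \<otimes>\<^bsub>opposite Q\<^esub> z b =
        \<eta> a \<otimes>\<^bsub>opposite Q\<^esub> z b \<oplus>\<^bsub>opposite Q\<^esub> \<eta> c" for b
    proof -
      obtain a c where ac: "a \<in> carrier R" "c \<in> carrier R" "z b \<otimes> z b = \<eta> a \<otimes> z b \<oplus> \<eta> c"
        using square by blast
      obtain d where d: "d \<in> carrier R" "\<eta> a \<otimes> z b = z b \<otimes> \<eta> (tau_inv b a) \<oplus> \<eta> d"
        using skew_right[OF ac(1)] by blast
      have "z b \<otimes> z b = z b \<otimes> \<eta> (tau_inv b a) \<oplus> \<eta> (d \<oplus>\<^bsub>R\<^esub> c)"
        using ac d by (simp add: S.a_assoc)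
      then show ?thesis
        using ac d by (intro bexI[of _ "tau_inv b a"] bexI[of _ "d \<oplus>\<^bsub>R\<^esub> c"]) simp_all
    qed
    show "carrier (opposite Q) \<subseteq> U"
      if "subring U (opposite Q)" "\<eta> ` carrier (opposite R) \<subseteq> U" "range z \<subseteq> U" for U
      using generates[OF subring_opposite[OF S.ring_axioms that(1)]] that(2,3) by simp
  qed
qed

theorem noetherian_extension:
  assumes "noetherian R"
  shows "noetherian Q"
proof -
  interpret op: alternating_extension "opposite R" "opposite Q" \<eta> z tau_inv
    by (rule alternating_extension_opposite)
  show ?thesis
    using assms left_noetherian_extension op.left_noetherian_extension
    by (simp add: noetherian_def left_noetherian_opposite)
qed

end


section \<open>The amalgamated product\<close>

text \<open>
  A subring that contains both images is itself a cocone. The induced map into it, followed by the inclusion,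
  and the identity of \<open>Q\<close> solve the same universal problem, so they coincide.
\<close>
lemma ring_pushout_generated:
  fixes Q :: "'q ring"
  assumes po: "ring_pushout R \<iota>1 Q1 \<iota>2 Q2 Q j1 j2"
    and U: "subring U Q" "j1 ` carrier Q1 \<subseteq> U" "j2 ` carrier Q2 \<subseteq> U"
  shows "carrier Q \<subseteq> U"
proof -
  have co: "ring_cocone R \<iota>1 Q1 \<iota>2 Q2 Q j1 j2"
    and univ: "\<And>(T :: 'q ring) f g. ring_cocone R \<iota>1 Q1 \<iota>2 Q2 T f g \<Longrightarrow>
        \<exists>!h. h \<in> ring_hom Q T \<and> h \<in> extensional (carrier Q) \<and>
              (\<forall>u\<in>carrier Q1. h (j1 u) = f u) \<and> (\<forall>v\<in>carrier Q2. h (j2 v) = g v)"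
    using po unfolding ring_pushout_def ring_pushout_for_def by auto
  interpret Q: ring Q using co by (simp add: ring_cocone_def)
  let ?T = "Q\<lparr>carrier := U\<rparr>"
  have "ring_cocone R \<iota>1 Q1 \<iota>2 Q2 ?T j1 j2"
    using co U Q.subring_is_ring[OF U(1)] by (auto simp: ring_cocone_def ring_hom_def)
  then obtain h where h: "h \<in> ring_hom Q ?T" "h \<in> extensional (carrier Q)"
      "\<forall>u\<in>carrier Q1. h (j1 u) = j1 u" "\<forall>v\<in>carrier Q2. h (j2 v) = j2 v"
    using univ[of ?T j1 j2] by blast
  have "h \<in> ring_hom Q Q" using h(1) subringE(1)[OF U(1)] by (auto simp: ring_hom_def)
  moreover have "restrict id (carrier Q) \<in> ring_hom Q Q" by (auto simp: ring_hom_def)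
  moreover have "j1 u \<in> carrier Q" if "u \<in> carrier Q1" for u
    using that co by (auto simp: ring_cocone_def ring_hom_closed)
  moreover have "j2 u \<in> carrier Q" if "u \<in> carrier Q2" for u
    using that co by (auto simp: ring_cocone_def ring_hom_closed)
  ultimately have eq: "h = restrict id (carrier Q)"
    using h by (intro ex1_unique[OF univ[OF co]]) auto
  show ?thesis
  proof
    fix u assume u: "u \<in> carrier Q"
    then have "h u \<in> U" using ring_hom_closed[OF h(1)] by simp
    then show "u \<in> U" using u eq by simp
  qed
qed

lemma (in quadratic_extension) image_subset:
  assumes j: "ring_hom_ring A T j" and U: "subring U T"
    and base: "(j \<circ> \<iota>) ` carrier R \<subseteq> U" and gen: "j x \<in> U"
  shows "j ` carrier A \<subseteq> U"
proof
  interpret j: ring_hom_ring A T j by fact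
  fix q assume "q \<in> j ` carrier A"
  then obtain w where w: "w \<in> carrier A" "q = j w" by blast
  obtain r s where rs: "r \<in> carrier R" "s \<in> carrier R" "w = \<iota> r \<oplus>\<^bsub>A\<^esub> \<iota> s \<otimes>\<^bsub>A\<^esub> x"
    using ex1_implies_ex[OF free[OF w(1)]] by auto
  then have "q = j (\<iota> r) \<oplus>\<^bsub>T\<^esub> j (\<iota> s) \<otimes>\<^bsub>T\<^esub> j x" using w(2) gen_closed by simp
  moreover have "j (\<iota> r) \<in> U" "j (\<iota> s) \<in> U" using base rs by auto
  ultimately show "q \<in> U" using gen subringE(6,7)[OF U] by simp
qed

lemma (in quadratic_extension) image_relations:
  assumes j: "ring_hom_ring A T j"
  shows "j x \<in> carrier T"
    and "r \<in> carrier R \<Longrightarrow>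
      j x \<otimes>\<^bsub>T\<^esub> j (\<iota> r) = j (\<iota> (\<tau> r)) \<otimes>\<^bsub>T\<^esub> j x \<oplus>\<^bsub>T\<^esub> j (\<iota> (\<delta> r))"
    and "\<delta> \<in> carrier R \<rightarrow> carrier R"
    and "j x \<otimes>\<^bsub>T\<^esub> j x = j (\<iota> a) \<otimes>\<^bsub>T\<^esub> j x \<oplus>\<^bsub>T\<^esub> j (\<iota> b)"
proof -
  interpret j: ring_hom_ring A T j by fact
  show "j x \<in> carrier T" using gen_closed by simp
  show \<delta>: "\<delta> \<in> carrier R \<rightarrow> carrier R" using deriv by (simp add: left_derivation_def)
  show "j x \<otimes>\<^bsub>T\<^esub> j x = j (\<iota> a) \<otimes>\<^bsub>T\<^esub> j x \<oplus>\<^bsub>T\<^esub> j (\<iota> b)"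
    using arg_cong[OF square, of j] gen_closed coeffs by simp
  assume r: "r \<in> carrier R"
  then have "\<tau> r \<in> carrier R" "\<delta> r \<in> carrier R"
    using endo \<delta> by (auto simp: ring_hom_closed)
  then show "j x \<otimes>\<^bsub>T\<^esub> j (\<iota> r) = j (\<iota> (\<tau> r)) \<otimes>\<^bsub>T\<^esub> j x \<oplus>\<^bsub>T\<^esub> j (\<iota> (\<delta> r))"
    using arg_cong[OF commute[OF r], of j] gen_closed r by simp
qed

theorem theorem1p3:
  fixes R :: "('r, 'm) ring_scheme"
    and Q1 :: "('a, 'n) ring_scheme" and Q2 :: "('b, 'o) ring_scheme"
    and Q :: "'q ring"
  assumes "noetherian R"
    and "quadratic_extension R Q1 \<iota>1 x \<tau>1 \<delta>1 a b"
    and "quadratic_extension R Q2 \<iota>2 y \<tau>2 \<delta>2 c d"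
    and "ring_pushout R \<iota>1 Q1 \<iota>2 Q2 Q j1 j2"
    and "\<tau>1 \<in> ring_iso R R" and "\<tau>2 \<in> ring_iso R R"
  shows "noetherian Q"
proof -
  interpret e1: quadratic_extension R Q1 \<iota>1 x \<tau>1 \<delta>1 a b by fact
  interpret e2: quadratic_extension R Q2 \<iota>2 y \<tau>2 \<delta>2 c d by fact
  have co: "ring Q" "j1 \<in> ring_hom Q1 Q" "j2 \<in> ring_hom Q2 Q"
      "\<And>r. r \<in> carrier R \<Longrightarrow> j1 (\<iota>1 r) = j2 (\<iota>2 r)"
    using assms(4) by (auto simp: ring_pushout_def ring_pushout_for_def ring_cocone_def)
  interpret j1: ring_hom_ring Q1 Q j1
    by (intro ring_hom_ringI2 co e1.S.ring_axioms)
  interpret j2: ring_hom_ring Q2 Q j2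
    by (intro ring_hom_ringI2 co e2.S.ring_axioms)
  define \<eta> where "\<eta> = j1 \<circ> \<iota>1"
  have \<eta>1: "\<eta> r = j1 (\<iota>1 r)" for r by (simp add: \<eta>_def)
  have \<eta>2: "\<eta> r = j2 (\<iota>2 r)" if "r \<in> carrier R" for r using that co(4) by (simp add: \<eta>_def)
  define z where "z t = (if t then j1 x else j2 y)" for t
  define \<tau> where "\<tau> t = (if t then \<tau>1 else \<tau>2)" for t
  note rel1 = e1.image_relations[OF j1.ring_hom_ring_axioms]
  note rel2 = e2.image_relations[OF j2.ring_hom_ring_axioms]
  have hom: "\<eta> \<in> ring_hom R Q"
    unfolding \<eta>_def by (rule ring_hom_trans[OF e1.homh co(2)])
  interpret \<eta>: ring_hom_ring R Q \<eta>
    by (intro ring_hom_ringI2 hom co(1) e1.R.ring_axioms)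
  interpret alternating_extension R Q \<eta> z \<tau>
  proof
    show "z t \<in> carrier Q" for t using rel1(1) rel2(1) by (simp add: z_def)
    show "\<tau> t \<in> ring_iso R R" for t using assms(5,6) by (simp add: \<tau>_def)
    show "\<exists>d\<in>carrier R. z t \<otimes>\<^bsub>Q\<^esub> \<eta> r = \<eta> (\<tau> t r) \<otimes>\<^bsub>Q\<^esub> z t \<oplus>\<^bsub>Q\<^esub> \<eta> d"
      if r: "r \<in> carrier R" for r t
    proof (cases t)
      case True
      then show ?thesis
        using rel1(2)[OF r] funcset_mem[OF rel1(3) r]
        by (intro bexI[of _ "\<delta>1 r"]) (simp_all add: z_def \<tau>_def \<eta>1)
    next
      case False
      then show ?thesis
        using rel2(2)[OF r] funcset_mem[OF rel2(3) r] ring_hom_closed[OF e2.endo r] r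
        by (intro bexI[of _ "\<delta>2 r"]) (simp_all add: z_def \<tau>_def \<eta>2)
    qed
    show "\<exists>a\<in>carrier R. \<exists>c\<in>carrier R. z t \<otimes>\<^bsub>Q\<^esub> z t = \<eta> a \<otimes>\<^bsub>Q\<^esub> z t \<oplus>\<^bsub>Q\<^esub> \<eta> c" for t
    proof (cases t)
      case True
      then show ?thesis
        using rel1(4) e1.coeffs
        by (intro bexI[of _ a] bexI[of _ b]) (simp_all add: z_def \<eta>1)
    next
      case False
      then show ?thesis
        using rel2(4) e2.coeffs
        by (intro bexI[of _ c] bexI[of _ d]) (simp_all add: z_def \<eta>2)
    qed
    show "carrier Q \<subseteq> U" if U: "subring U Q" "\<eta> ` carrier R \<subseteq> U" "range z \<subseteq> U" for U
    proof (rule ring_pushout_generated[OF assms(4) U(1)])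
      have "j1 x \<in> U" "j2 y \<in> U" using U(3) by (auto simp: z_def image_subset_iff split: if_splits)
      moreover have "(j2 \<circ> \<iota>2) ` carrier R \<subseteq> U" using U(2) \<eta>2 by auto
      ultimately show "j1 ` carrier Q1 \<subseteq> U" "j2 ` carrier Q2 \<subseteq> U"
        using e1.image_subset[OF j1.ring_hom_ring_axioms U(1)] U(2)
          e2.image_subset[OF j2.ring_hom_ring_axioms U(1)] by (auto simp: \<eta>_def)
    qed
  qed
  show ?thesis by (rule noetherian_extension[OF assms(1)])
qed

end
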